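(* The language $L(G)$ defined by each LL($k$) linear conjunctive grammar $G=(\Sigma,N,R,S)$ is decidable in logarithmic space and linear time.
   Context: A linear conjunctive grammar is a quadruple $G=(\Sigma,N,R,S)$, where $\Sigma$ is a finite alphabet, $N$ is a finite set of nonterminals, $S\in N$ is the initial nonterminal, and $R$ is a finite set of rules, each either of the form $A\to u_1B_1v_1\,\&\cdots\&\,u_rB_rv_r$ with $A,B_1,\ldots,B_r\in N$ and $u_i,v_i\in\Sigma^*$ (each $u_iB_iv_i$ is called a conjunct), or of the form $A\to y$ with $A\in N$, $y\in\Sigma^*$. Parse trees. A parse tree of a string $w\in\Sigma^*$ as $A\in N$ has a root labelled $A$ and the symbols of $w$ as its ordered leaves, and either a rule $A\to w\in R$ is applied at the root (whose immediate descendants are all the leaves), or a rule $A\to u_1B_1v_1\,\&\cdots\&\,u_rB_rv_r\in R$ is applied at the root, where for each $i$ one has $w=u_iy_iv_i$ for some $y_i$, and the root has, for each $i$, a separate group of descendants: the first $|u_i|$ leaves, a node labelled $B_i$ which is the root of a parse tree of $y_i$ as $B_i$, and the last $|v_i|$ leaves (all conjuncts share the same leaves). $L_G(A)$ is the set of strings having a parse tree as $A$, and $L(G)=L_G(S)$. A parse tree with no nonterminal mentioned is a parse tree as $S$. LL($k$) grammars. An LL($k$) table for $G$ is a partial function $T\colon N\times\Sigma^{\le k}\to R$ such that for every subtree $\tau$ of any parse tree, if $A\in N$ is the label of the root of $\tau$ and $x\in\Sigma^{\le k}$ is the string of the first $k$ leaves of the whole parse tree starting from the first leaf of $\tau$ (all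 remaining leaves, if fewer than $k$ remain), then the rule applied at the root of $\tau$ is $T(A,x)$. $G$ is LL($k$) if an LL($k$) table for it exists. *)

theory Defs
  imports
    Complex_Main
    "HOL-Library.Landau_Symbols"
    "HOL-Library.Discrete_Functions"
begin

section \<open>Linear conjunctive grammars\<close>

text \<open>
  \<open>Conj A [(u\<^sub>1, B\<^sub>1, v\<^sub>1), \<dots>, (u\<^sub>r, B\<^sub>r, v\<^sub>r)]\<close> is the rule
  \<open>A \<rightarrow> u\<^sub>1 B\<^sub>1 v\<^sub>1 & \<dots> & u\<^sub>r B\<^sub>r v\<^sub>r\<close>, and \<open>Word A y\<close> is the rule \<open>A \<rightarrow> y\<close>.
\<close>

datatype ('a, 'n) rule =
    Word (lhs: 'n) "'a list"
  | Conj (lhs: 'n) "('a list \<times> 'n \<times> 'a list) list"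

record ('a, 'n) grammar =
  alphabet :: "'a set"
  nonterminals :: "'n set"
  rules :: "('a, 'n) rule set"
  start :: 'n

fun well_formed_rule :: "('a, 'n) grammar \<Rightarrow> ('a, 'n) rule \<Rightarrow> bool" where
  "well_formed_rule G (Word A y) \<longleftrightarrow> A \<in> nonterminals G \<and> y \<in> lists (alphabet G)"
| "well_formed_rule G (Conj A cs) \<longleftrightarrow> A \<in> nonterminals G \<and> cs \<noteq> [] \<and>
     (\<forall>(u, B, v) \<in> set cs.
        u \<in> lists (alphabet G) \<and> B \<in> nonterminals G \<and> v \<in> lists (alphabet G))"

definition linear_conjunctive_grammar :: "('a, 'n) grammar \<Rightarrow> bool" where
  "linear_conjunctive_grammar G \<longleftrightarrow>
     finite (alphabet G) \<and> finite (nonterminals G) \<and> start G \<in> nonterminals G \<and>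
     finite (rules G) \<and> (\<forall>r \<in> rules G. well_formed_rule G r)"


section \<open>Parse trees\<close>

text \<open>
  The conjuncts of a rule share the same leaves, so a node carries the string of its leaves
  and, for each conjunct, the subtree rooted at the nonterminal of that conjunct; the first
  \<open>|u\<^sub>i|\<close> and the last \<open>|v\<^sub>i|\<close> leaves outside of this subtree need no further record.
  The label of the root is the left-hand side of the rule applied there.
\<close>

datatype ('a, 'n) ptree =
  Node (leaves: "'a list") (root_rule: "('a, 'n) rule") (subtrees: "('a, 'n) ptree list")

abbreviation root_label :: "('a, 'n) ptree \<Rightarrow> 'n" where
  "root_label t \<equiv> lhs (root_rule t)"

inductive parse_tree :: "('a, 'n) grammar \<Rightarrow> 'n \<Rightarrow> 'a list \<Rightarrow> ('a, 'n) ptree \<Rightarrow> bool"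
  for G :: "('a, 'n) grammar" where
  Word: "Word A w \<in> rules G \<Longrightarrow> parse_tree G A w (Node w (Word A w) [])"
| Conj: "Conj A cs \<in> rules G \<Longrightarrow>
     length ts = length cs \<Longrightarrow>
     \<forall>i < length cs. \<exists>u B v y. cs ! i = (u, B, v) \<and> w = u @ y @ v \<and> parse_tree G B y (ts ! i) \<Longrightarrow>
     parse_tree G A w (Node w (Conj A cs) ts)"

definition language_of :: "('a, 'n) grammar \<Rightarrow> 'n \<Rightarrow> 'a list set" where
  "language_of G A = {w \<in> lists (alphabet G). \<exists>t. parse_tree G A w t}"

definition language :: "('a, 'n) grammar \<Rightarrow> 'a list set" where
  "language G = language_of G (start G)"

text \<open>
  \<open>subtree_at t p s\<close>: \<open>s\<close> occurs in \<open>t\<close> as a subtree with exactly \<open>p\<close> leaves of \<open>t\<close>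
  preceding it. The position is tracked separately because \<open>s\<close> may have no leaves.
\<close>

inductive subtree_at :: "('a, 'n) ptree \<Rightarrow> nat \<Rightarrow> ('a, 'n) ptree \<Rightarrow> bool"
  for t :: "('a, 'n) ptree" where
  root: "subtree_at t 0 t"
| child: "subtree_at t p (Node w (Conj A cs) ts) \<Longrightarrow>
     i < length cs \<Longrightarrow> i < length ts \<Longrightarrow> cs ! i = (u, B, v) \<Longrightarrow>
     subtree_at t (p + length u) (ts ! i)"


section \<open>LL(k) grammars\<close>

definition LL_table ::
    "('a, 'n) grammar \<Rightarrow> nat \<Rightarrow> ('n \<times> 'a list \<rightharpoonup> ('a, 'n) rule) \<Rightarrow> bool" where
  "LL_table G k T \<longleftrightarrow>
     dom T \<subseteq> nonterminals G \<times> {x \<in> lists (alphabet G). length x \<le> k} \<and>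
     ran T \<subseteq> rules G \<and>
     (\<forall>w t p s. parse_tree G (start G) w t \<longrightarrow> subtree_at t p s \<longrightarrow>
        T (root_label s, take k (drop p w)) = Some (root_rule s))"

definition LL :: "nat \<Rightarrow> ('a, 'n) grammar \<Rightarrow> bool" where
  "LL k G \<longleftrightarrow> (\<exists>T. LL_table G k T)"


section \<open>Random access machines\<close>

text \<open>
  A machine has random access to a read-only input string and works with registers holding
  natural numbers, initially zero. \<open>Test r x l\<close> jumps to \<open>l\<close> if the input symbol at the position
  (counted from zero) stored in register \<open>r\<close> is \<open>x\<close>, with \<open>x = None\<close> standing for a position
  past the end of the input. There is neither indirect addressing of registers nor
  multiplication, so a program uses only the registers named in it and every instruction
  takes unit time; space is the total length of the binary notations of the register contents.
\<close>

datatype 'a instr =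
    Const nat nat
  | Copy nat nat
  | Add nat nat nat
  | Sub nat nat nat
  | Jump nat
  | JumpZero nat nat
  | Test nat "'a option" nat
  | Accept
  | Reject

fun registers :: "'a instr \<Rightarrow> nat set" where
  "registers (Const r c) = {r}"
| "registers (Copy r s) = {r, s}"
| "registers (Add r s t) = {r, s, t}"
| "registers (Sub r s t) = {r, s, t}"
| "registers (Jump l) = {}"
| "registers (JumpZero r l) = {r}"
| "registers (Test r x l) = {r}"
| "registers Accept = {}"
| "registers Reject = {}"

datatype config = Running nat "nat \<Rightarrow> nat" | Halted bool

definition input_symbol :: "'a list \<Rightarrow> nat \<Rightarrow> 'a option" where
  "input_symbol w i = (if i < length w then Some (w ! i) else None)"

fun exec :: "'a list \<Rightarrow> 'a instr \<Rightarrow> nat \<Rightarrow> (nat \<Rightarrow> nat) \<Rightarrow> config" where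
  "exec w (Const r c) pc R = Running (Suc pc) (R(r := c))"
| "exec w (Copy r s) pc R = Running (Suc pc) (R(r := R s))"
| "exec w (Add r s t) pc R = Running (Suc pc) (R(r := R s + R t))"
| "exec w (Sub r s t) pc R = Running (Suc pc) (R(r := R s - R t))"
| "exec w (Jump l) pc R = Running l R"
| "exec w (JumpZero r l) pc R = Running (if R r = 0 then l else Suc pc) R"
| "exec w (Test r x l) pc R = Running (if input_symbol w (R r) = x then l else Suc pc) R"
| "exec w Accept pc R = Halted True"
| "exec w Reject pc R = Halted False"

text \<open>A machine that leaves its program runs forever without halting.\<close>

fun step :: "'a instr list \<Rightarrow> 'a list \<Rightarrow> config \<Rightarrow> config" where
  "step P w (Running pc R) = (if pc < length P then exec w (P ! pc) pc R else Running pc R)"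
| "step P w (Halted b) = Halted b"

definition config_after :: "'a instr list \<Rightarrow> 'a list \<Rightarrow> nat \<Rightarrow> config" where
  "config_after P w n = (step P w ^^ n) (Running 0 (\<lambda>_. 0))"

text \<open>The number of binary digits, where \<open>0\<close> has a single digit.\<close>

definition bit_size :: "nat \<Rightarrow> nat" where
  "bit_size m = Suc (floor_log m)"

fun space :: "'a instr list \<Rightarrow> config \<Rightarrow> nat" where
  "space P (Running pc R) = (\<Sum>r \<in> (\<Union>c \<in> set P. registers c). bit_size (R r))"
| "space P (Halted b) = 0"

text \<open>The space bound \<open>S\<close> and the time bound \<open>T\<close> apply to one and the same machine.\<close>

definition decidable_in_space_time ::
    "'a set \<Rightarrow> 'a list set \<Rightarrow> (nat \<Rightarrow> real) \<Rightarrow> (nat \<Rightarrow> real) \<Rightarrow> bool" where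
  "decidable_in_space_time \<Sigma> L S T \<longleftrightarrow>
     (\<exists>P. \<forall>w \<in> lists \<Sigma>.
        (\<exists>n. real n \<le> T (length w) \<and> config_after P w n = Halted (w \<in> L)) \<and>
        (\<forall>n. real (space P (config_after P w n)) \<le> S (length w)))"

end

theory Submission
  imports Defs "HOL-Library.Nat_Bijection"
begin

text \<open>
  If the rule applied to a nonterminal \<open>A\<close> at a position \<open>p\<close> of the input is prescribed by a table,
  then the whole derivation starting there is determined, and with it the position \<open>q\<close> where
  it ends. For a grammar with bounded prefixes \<open>u\<close> in its conjuncts, all ends for position \<open>p\<close>
  can be found from those for \<open>p, \<dots>, p + D\<close>, which fit into finitely many
  registers of logarithmic size. A machine moving \<open>p\<close> from the end of the input to its beginning
  thus spends constant time on each position; it accepts if the derivation from the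
  initial nonterminal at \<open>0\<close> ends at the end of the input.
\<close>

text \<open>What is recorded about a derivation is its end and not its string. Random access then
  allows the suffix \<open>v\<close> of a conjunct to be compared with the input at the recorded
  end, however far away, while the subderivation itself starts only \<open>length u \<le> D\<close>
  symbols further right; this is why a window of \<open>D + 1\<close> positions is enough.

  An LL table is constrained only along parse trees of strings in the language; elsewhere its
  entries may be any rules of the grammar. Hence the guided derivations \<open>der\<close> are
  defined at every position and for every nonterminal. Each of them yields a genuine parse tree,
  whereas a parse tree is turned into a guided derivation only where it is a subtree of a parse tree
  of the whole input. This suffices, because the final verdict rests on the derivation from the
  initial nonterminal at \<open>0\<close> alone.

  The space bound has to hold at every moment, and an addition may double a register. The run is
  therefore cut into segments of constantly many steps, at whose ends all registers are at most
  \<open>length w + 1\<close>.\<close>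

section \<open>Loop-free code\<close>

text \<open>Without loops the semantics is a total function on register contents, and correctness
  can be shown without program counters.\<close>

datatype 'a stmt =
    Skip
  | SConst nat nat
  | SCopy nat nat
  | SAdd nat nat nat
  | SSub nat nat nat
  | Seq "'a stmt" "'a stmt"
  | IfZero nat "'a stmt" "'a stmt"
  | IfSymbol nat "'a option" "'a stmt" "'a stmt"

primrec sem :: "'a list \<Rightarrow> 'a stmt \<Rightarrow> (nat \<Rightarrow> nat) \<Rightarrow> (nat \<Rightarrow> nat)" where
  "sem w Skip R = R"
| "sem w (SConst r c) R = R(r := c)"
| "sem w (SCopy r s) R = R(r := R s)"
| "sem w (SAdd r s t) R = R(r := R s + R t)"
| "sem w (SSub r s t) R = R(r := R s - R t)"
| "sem w (Seq s1 s2) R = sem w s2 (sem w s1 R)"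
| "sem w (IfZero r s1 s2) R = (if R r = 0 then sem w s1 R else sem w s2 R)"
| "sem w (IfSymbol r x s1 s2) R =
     (if input_symbol w (R r) = x then sem w s1 R else sem w s2 R)"

primrec stmt_size :: "'a stmt \<Rightarrow> nat" where
  "stmt_size Skip = 0"
| "stmt_size (SConst r c) = 1"
| "stmt_size (SCopy r s) = 1"
| "stmt_size (SAdd r s t) = 1"
| "stmt_size (SSub r s t) = 1"
| "stmt_size (Seq s1 s2) = stmt_size s1 + stmt_size s2"
| "stmt_size (IfZero r s1 s2) = 2 + stmt_size s2 + stmt_size s1"
| "stmt_size (IfSymbol r x s1 s2) = 2 + stmt_size s2 + stmt_size s1"

text \<open>Jump targets of the machine are absolute, so the translation depends on the address
  \<open>b\<close> of its first instruction. In a conditional the second branch is placed first,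
  since it is reached by falling through the test.\<close>

primrec code :: "nat \<Rightarrow> 'a stmt \<Rightarrow> 'a instr list" where
  "code b Skip = []"
| "code b (SConst r c) = [Const r c]"
| "code b (SCopy r s) = [Copy r s]"
| "code b (SAdd r s t) = [Add r s t]"
| "code b (SSub r s t) = [Sub r s t]"
| "code b (Seq s1 s2) = code b s1 @ code (b + stmt_size s1) s2"
| "code b (IfZero r s1 s2) =
     JumpZero r (b + 2 + stmt_size s2) # code (b + 1) s2 @
     Jump (b + 2 + stmt_size s2 + stmt_size s1) # code (b + 2 + stmt_size s2) s1"
| "code b (IfSymbol r x s1 s2) =
     Test r x (b + 2 + stmt_size s2) # code (b + 1) s2 @
     Jump (b + 2 + stmt_size s2 + stmt_size s1) # code (b + 2 + stmt_size s2) s1"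

lemma length_code [simp]: "length (code b s) = stmt_size s"
  by (induction s arbitrary: b) auto

fun code_at :: "'a instr list \<Rightarrow> nat \<Rightarrow> 'a instr list \<Rightarrow> bool" where
  "code_at P b [] \<longleftrightarrow> True"
| "code_at P b (i # c) \<longleftrightarrow> b < length P \<and> P ! b = i \<and> code_at P (Suc b) c"

lemma code_at_append [simp]:
  "code_at P b (c @ d) \<longleftrightarrow> code_at P b c \<and> code_at P (b + length c) d"
  by (induction c arbitrary: b) auto

lemma code_at_self: "code_at (pre @ c) (length pre) c"
proof (induction c arbitrary: pre)
  case (Cons i c)
  from Cons[of "pre @ [i]"] show ?case by simp
qed simp

definition reaches :: "'a instr list \<Rightarrow> 'a list \<Rightarrow> nat \<Rightarrow> config \<Rightarrow> config \<Rightarrow> bool" where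
  "reaches P w t c c' \<longleftrightarrow> (\<exists>j\<le>t. (step P w ^^ j) c = c')"

lemma reaches_0: "reaches P w 0 c c"
  by (auto simp: reaches_def)

lemma reaches_step: "step P w c = c' \<Longrightarrow> reaches P w 1 c c'"
  unfolding reaches_def by (intro exI[of _ 1]) auto

lemma reaches_trans:
  assumes "reaches P w t c c'" and "reaches P w u c' c''"
  shows "reaches P w (t + u) c c''"
proof -
  from assms obtain j i where "j \<le> t" "i \<le> u" "(step P w ^^ j) c = c'" "(step P w ^^ i) c' = c''"
    by (auto simp: reaches_def)
  then show ?thesis
    unfolding reaches_def by (intro exI[of _ "i + j"]) (auto simp: funpow_add)
qed

lemma reaches_mono: "reaches P w t c c' \<Longrightarrow> t \<le> u \<Longrightarrow> reaches P w u c c'"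
  by (auto simp: reaches_def intro: order_trans)

lemma reaches_Cons_step:
  "step P w c = c' \<Longrightarrow> reaches P w t c' c'' \<Longrightarrow> reaches P w (Suc t) c c''"
  using reaches_trans[OF reaches_step] by force

text \<open>The two kinds of conditional differ only in their test; this is their common control
  flow.\<close>

lemma reaches_branch:
  assumes test: "step P w (Running b R) = Running (if t then b + 2 + n2 else b + 1) R"
    and s2: "reaches P w n2 (Running (b + 1) R) (Running (b + 1 + n2) R2)"
    and jump: "b + 1 + n2 < length P" "P ! (b + 1 + n2) = Jump (b + 2 + n2 + n1)"
    and s1: "reaches P w n1 (Running (b + 2 + n2) R) (Running (b + 2 + n2 + n1) R1)"
  shows "reaches P w (2 + n2 + n1) (Running b R)
    (Running (b + 2 + n2 + n1) (if t then R1 else R2))"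
proof (cases t)
  case True
  then show ?thesis
    using reaches_mono[OF reaches_Cons_step[OF test, of n1], of _ "2 + n2 + n1"] s1 by auto
next
  case False
  have "reaches P w 1 (Running (b + 1 + n2) R2) (Running (b + 2 + n2 + n1) R2)"
    using jump by (intro reaches_step) simp
  from reaches_mono[OF reaches_Cons_step[OF test, of "n2 + 1"], of _ "2 + n2 + n1"]
    reaches_trans[OF s2 this] False show ?thesis by auto
qed

text \<open>All jumps lead forward, so each instruction is executed at most once and the length of
  the code bounds the time.\<close>

lemma reaches_code:
  "code_at P b (code b s) \<Longrightarrow>
     reaches P w (stmt_size s) (Running b R) (Running (b + stmt_size s) (sem w s R))"
proof (induction s arbitrary: b R)
  case (Seq s1 s2)
  then show ?case
    using reaches_trans[OF Seq.IH(1) Seq.IH(2)] by (simp add: add.assoc)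
next
  case (IfZero r s1 s2)
  have "reaches P w (stmt_size s2) (Running (b + 1) R)
      (Running (b + 1 + stmt_size s2) (sem w s2 R))"
    using IfZero by (intro IfZero.IH) simp
  moreover have "reaches P w (stmt_size s1) (Running (b + 2 + stmt_size s2) R)
      (Running (b + 2 + stmt_size s2 + stmt_size s1) (sem w s1 R))"
    using IfZero by (intro IfZero.IH) simp
  ultimately show ?case
    using reaches_branch[of P w b R "R r = 0" "stmt_size s2" "sem w s2 R" "stmt_size s1" "sem w s1 R"]
      IfZero.prems by (simp add: add.assoc)
next
  case (IfSymbol r x s1 s2)
  have "reaches P w (stmt_size s2) (Running (b + 1) R)
      (Running (b + 1 + stmt_size s2) (sem w s2 R))"
    using IfSymbol by (intro IfSymbol.IH) simp
  moreover have "reaches P w (stmt_size s1) (Running (b + 2 + stmt_size s2) R)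
      (Running (b + 2 + stmt_size s2 + stmt_size s1) (sem w s1 R))"
    using IfSymbol by (intro IfSymbol.IH) simp
  ultimately show ?case
    using reaches_branch[of P w b R "input_symbol w (R r) = x" "stmt_size s2" "sem w s2 R"
        "stmt_size s1" "sem w s1 R"]
      IfSymbol.prems by (simp add: add.assoc)
qed (auto intro!: reaches_step[unfolded One_nat_def] reaches_0)


section \<open>Time and space of iterated code\<close>

fun bounded_by :: "nat \<Rightarrow> config \<Rightarrow> bool" where
  "bounded_by M (Running pc R) \<longleftrightarrow> (\<forall>r. R r \<le> M)"
| "bounded_by M (Halted b) \<longleftrightarrow> True"

lemma bounded_by_mono: "bounded_by M c \<Longrightarrow> M \<le> M' \<Longrightarrow> bounded_by M' c"
  by (cases c) (auto intro: order_trans)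

definition consts_below :: "nat \<Rightarrow> 'a instr list \<Rightarrow> bool" where
  "consts_below C P \<longleftrightarrow> (\<forall>r c. Const r c \<in> set P \<longrightarrow> c \<le> C)"

lemma consts_below_exists: "\<exists>C. consts_below C P"
proof (induction P)
  case (Cons i P)
  then obtain C where C: "consts_below C P" ..
  define c where "c = (case i of Const r c \<Rightarrow> c | _ \<Rightarrow> 0)"
  have "consts_below (C + c) (i # P)"
    using C unfolding consts_below_def c_def by (fastforce intro: trans_le_add1)
  then show ?case ..
qed (simp add: consts_below_def)

text \<open>An addition at most doubles the largest content, truncated subtraction never exceeds it,
  and a constant is at most \<open>C\<close>.\<close>

lemma bounded_by_step:
  assumes C: "consts_below C P" and c: "bounded_by M c"
  shows "bounded_by (2 * M + C) (step P w c)"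
proof (cases c)
  case (Running pc R)
  have R: "R r \<le> 2 * M + C" "R r + R s \<le> 2 * M + C" "R r - R s \<le> 2 * M + C" for r s
  proof -
    have "R r \<le> M" "R s \<le> M" using c Running by auto
    then show "R r \<le> 2 * M + C" "R r + R s \<le> 2 * M + C" "R r - R s \<le> 2 * M + C" by auto
  qed
  have *: "pc < length P \<Longrightarrow> P ! pc = Const r d \<Longrightarrow> d \<le> 2 * M + C" for r d
    using C nth_mem[of pc P] unfolding consts_below_def by (metis trans_le_add2)
  show ?thesis
    using Running R * by (cases "P ! pc") auto
qed simp

text \<open>The bound is the solution of the recurrence \<open>x \<mapsto> 2 * x + C\<close> with
  initial value \<open>M\<close>.\<close>

lemma bounded_by_steps:
  assumes C: "consts_below C P" and "bounded_by M c"
  shows "bounded_by (2 ^ j * (M + C) - C) ((step P w ^^ j) c)"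
proof (induction j)
  case (Suc j)
  have "C \<le> 2 ^ j * (M + C)"
    by (metis le_add2 mult.commute mult_le_mono2 nat_mult_1_right one_le_numeral one_le_power order_trans)
  then have "2 * (2 ^ j * (M + C) - C) + C = 2 ^ Suc j * (M + C) - C"
    by (simp add: algebra_simps)
  with bounded_by_step[OF C Suc.IH, of w] show ?case by simp
qed (use assms in simp)

lemma halted_steps: "(step P w ^^ j) (Halted b) = Halted b"
  by (induction j) auto

text \<open>
  Within a segment of constantly many steps the register contents grow by a constant factor
  only, so it is sufficient to bound them at the ends of such segments.
\<close>

lemma segments_terminate:
  assumes C: "consts_below C P"
    and seg: "\<And>c i. H i c \<Longrightarrow> bounded_by M c \<and>
       (reaches P w t c (Halted b) \<or> (\<exists>i' c'. i' < i \<and> H i' c' \<and> reaches P w t c c'))"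
    and "H i c"
  shows "reaches P w (t * Suc i) c (Halted b) \<and>
    (\<forall>m. bounded_by (2 ^ t * (M + C)) ((step P w ^^ m) c))"
  using \<open>H i c\<close>
proof (induction i arbitrary: c rule: less_induct)
  case (less i)
  have short: "bounded_by (2 ^ t * (M + C)) ((step P w ^^ m) c)" if "m \<le> t" for m
  proof -
    have "bounded_by (2 ^ m * (M + C) - C) ((step P w ^^ m) c)"
      using bounded_by_steps[OF C] seg[OF less.prems] by blast
    moreover have "2 ^ m * (M + C) - C \<le> 2 ^ t * (M + C)"
      using that by (intro order_trans[OF diff_le_self] mult_le_mono power_increasing) auto
    ultimately show ?thesis by (rule bounded_by_mono)
  qed
  \<comment> \<open>Up to step \<open>j\<close> the growth within one segment gives the bound; every
    later configuration belongs to the run from the end of that segment.\<close>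
  have split: "bounded_by (2 ^ t * (M + C)) ((step P w ^^ m) c)"
    if j: "j \<le> t" and rest: "\<And>m. bounded_by (2 ^ t * (M + C)) ((step P w ^^ m) ((step P w ^^ j) c))"
    for j m
  proof (cases "m \<le> j")
    case False
    then have "(step P w ^^ m) c = (step P w ^^ (m - j)) ((step P w ^^ j) c)"
      by (metis add_diff_inverse_nat comp_apply funpow_add le_add_diff_inverse2 nat_le_linear)
    with rest show ?thesis by simp
  qed (use short j in auto)
  from seg[OF less.prems] consider "reaches P w t c (Halted b)"
    | i' c' where "i' < i" "H i' c'" "reaches P w t c c'" by blast
  then show ?case
  proof cases
    case 1
    then obtain j where j: "j \<le> t" "(step P w ^^ j) c = Halted b" by (auto simp: reaches_def)
    have "reaches P w (t * Suc i) c (Halted b)"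
      using 1 by (rule reaches_mono) simp
    moreover have "bounded_by (2 ^ t * (M + C)) ((step P w ^^ m) c)" for m
      using split[OF j(1), of m] j(2) by (simp add: halted_steps)
    ultimately show ?thesis by blast
  next
    case 2
    then obtain j where j: "j \<le> t" "(step P w ^^ j) c = c'" by (auto simp: reaches_def)
    note IH = less.IH[OF 2(1,2)]
    have "reaches P w (t + t * Suc i') c (Halted b)"
      using reaches_trans[OF 2(3)] IH by blast
    moreover have "t + t * Suc i' \<le> t * Suc i"
      using mult_le_mono2[of "Suc (Suc i')" "Suc i" t] 2(1) by simp
    ultimately have "reaches P w (t * Suc i) c (Halted b)" by (rule reaches_mono)
    moreover have "bounded_by (2 ^ t * (M + C)) ((step P w ^^ m) c)" for m
      using split[OF j(1), of m] j(2) IH by simp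
    ultimately show ?thesis by blast
  qed
qed


section \<open>Derivations guided by the table\<close>

primrec matches :: "'a list \<Rightarrow> nat \<Rightarrow> 'a list \<Rightarrow> bool" where
  "matches w p [] \<longleftrightarrow> True"
| "matches w p (a # u) \<longleftrightarrow> input_symbol w p = Some a \<and> matches w (Suc p) u"

lemma matches_iff: "matches w p u \<longleftrightarrow> take (length u) (drop p w) = u"
proof (induction u arbitrary: p)
  case (Cons a u)
  show ?case
  proof (cases "p < length w")
    case True
    then show ?thesis
      using Cons by (simp add: input_symbol_def Cons_nth_drop_Suc[symmetric])
  qed (simp add: input_symbol_def)
qed simp

lemma matches_le: "matches w p u \<Longrightarrow> p \<le> length w \<Longrightarrow> p + length u \<le> length w"
  by (induction u arbitrary: p) (force simp: input_symbol_def split: if_splits)+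

text \<open>A lookahead shorter than \<open>k\<close> occurs only where the input ends. The machine
  thus recognizes \<open>x\<close> by comparing symbols, followed by a single test for the end of
  the input if \<open>x\<close> is short.\<close>

lemma lookahead_iff:
  "take k (drop p w) = x \<longleftrightarrow>
     length x \<le> k \<and> matches w p x \<and> (length x = k \<or> input_symbol w (p + length x) = None)"
proof -
  have "take k (drop p w) = x \<longleftrightarrow> length x \<le> k \<and> take (length x) (drop p w) = x \<and>
      (length x = k \<or> length w \<le> p + length x)"
    by (auto simp: min_def)
  then show ?thesis by (auto simp: matches_iff input_symbol_def)
qed

text \<open>All finite data from which the program is built. The list \<open>es\<close> keeps only
  entries with \<open>lhs r = A\<close>: at arguments that occur in no parse tree, the table may
  return a rule for another nonterminal.\<close>

locale ll_recognizer =
  fixes G :: "('a, 'n) grammar" and k :: nat and T :: "'n \<times> 'a list \<rightharpoonup> ('a, 'n) rule"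
    and idx :: "'n \<Rightarrow> nat" and D :: nat and Ns :: "'n list"
    and es :: "('n \<times> 'a list \<times> ('a, 'n) rule) list"
  assumes lin: "linear_conjunctive_grammar G"
    and table: "LL_table G k T"
    and idx: "inj_on idx (nonterminals G)"
    and D: "\<And>A cs u B v. Conj A cs \<in> rules G \<Longrightarrow> (u, B, v) \<in> set cs \<Longrightarrow> length u \<le> D"
    and Ns: "set Ns = nonterminals G" "distinct Ns"
    and es: "set es = {(A, x, r). T (A, x) = Some r \<and> lhs r = A}"
begin

abbreviation N where "N \<equiv> nonterminals G"

lemma entryD: "T (A, x) = Some r \<Longrightarrow> r \<in> rules G \<and> A \<in> N \<and> length x \<le> k"
  using table unfolding LL_table_def ran_def dom_def by blast

lemma conj_ruleD:
  assumes "Conj A cs \<in> rules G"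
  shows "cs \<noteq> []" and "(u, B, v) \<in> set cs \<Longrightarrow> B \<in> N"
  using assms lin unfolding linear_conjunctive_grammar_def by fastforce+

text \<open>The premise \<open>p \<le> length w\<close> excludes empty derivations beyond the end of
  the input, where the lookahead is empty as well.\<close>

inductive der :: "'a list \<Rightarrow> 'n \<Rightarrow> nat \<Rightarrow> nat \<Rightarrow> bool" for w where
  word: "p \<le> length w \<Longrightarrow> T (A, take k (drop p w)) = Some (Word A y) \<Longrightarrow> matches w p y \<Longrightarrow>
     der w A p (p + length y)"
| conj: "p \<le> length w \<Longrightarrow> T (A, take k (drop p w)) = Some (Conj A cs) \<Longrightarrow>
     \<forall>(u, B, v) \<in> set cs. \<exists>q'. matches w p u \<and> der w B (p + length u) q' \<and>
       matches w q' v \<and> q = q' + length v \<Longrightarrow>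
     der w A p q"

lemma der_bounds: "der w A p q \<Longrightarrow> p \<le> q \<and> q \<le> length w"
proof (induction rule: der.induct)
  case (word p A y)
  then show ?case using matches_le by fastforce
next
  case (conj p A cs q)
  \<comment> \<open>Without conjuncts the end \<open>q\<close> would be unconstrained, so the bound
    has to come from some conjunct.\<close>
  have "cs \<noteq> []" using conj_ruleD(1) entryD[OF conj(2)] by blast
  then obtain u B v where "(u, B, v) \<in> set cs"
    by (metis list.set_intros(1) neq_Nil_conv prod_cases3)
  with conj(3) show ?case using matches_le by fastforce
qed

text \<open>The table determines the rule from \<open>A\<close> and \<open>p\<close>, and by
  induction any single conjunct of it determines the end.\<close>

lemma der_unique: "der w A p q \<Longrightarrow> der w A p q' \<Longrightarrow> q = q'"
proof (induction arbitrary: q' rule: der.induct)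
  case (word p A y)
  from word(4,2) show ?case by cases auto
next
  case (conj p A cs q)
  have "cs \<noteq> []" using conj_ruleD(1) entryD[OF conj(2)] by blast
  then obtain u B v where uBv: "(u, B, v) \<in> set cs"
    by (metis list.set_intros(1) neq_Nil_conv prod_cases3)
  from conj(4) show ?case
  proof cases
    case (conj cs')
    then have "cs' = cs" using \<open>T _ = Some (Conj A cs)\<close> by simp
    with uBv conj(3) obtain q1 where "der w B (p + length u) q1" "q' = q1 + length v" by fastforce
    with uBv \<open>\<forall>(u, B, v)\<in>set cs. _\<close> show ?thesis by fastforce
  qed (use conj(2) in auto)
qed

text \<open>Table entries are rules of the grammar, and the common end of the conjuncts makes them
  share the same leaves.\<close>

lemma der_parse_tree: "der w A p q \<Longrightarrow> \<exists>t. parse_tree G A (take (q - p) (drop p w)) t"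
proof (induction rule: der.induct)
  case (word p A y)
  then have "Word A y \<in> rules G" using entryD by blast
  from parse_tree.Word[OF this] show ?case using word by (auto simp: matches_iff)
next
  case (conj p A cs q)
  let ?x = "take (q - p) (drop p w)"
  have r: "Conj A cs \<in> rules G" using entryD[OF conj(2)] by blast
  have "\<exists>s u B v y. cs ! i = (u, B, v) \<and> ?x = u @ y @ v \<and> parse_tree G B y s"
    if i: "i < length cs" for i
  proof -
    obtain u B v where c: "cs ! i = (u, B, v)" by (metis prod_cases3)
    then have "(u, B, v) \<in> set cs" using i by (metis nth_mem)
    with conj(3) obtain q' s where q': "matches w p u" "der w B (p + length u) q'"
      "matches w q' v" "q = q' + length v"
      "parse_tree G B (take (q' - (p + length u)) (drop (p + length u) w)) s" by fast
    define b where "b = q' - (p + length u)"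
    have b: "q' = p + length u + b" using der_bounds[OF q'(2)] by (simp add: b_def)
    have "?x = take (length u + (b + length v)) (drop p w)"
      using q'(4) b by (simp add: algebra_simps)
    also have "\<dots> = u @ take b (drop (p + length u) w) @ v"
      using q'(1,3) b unfolding take_add matches_iff by (simp add: add.commute add.left_commute)
    finally show ?thesis using c q'(5) unfolding b_def by blast
  qed
  then obtain s where s: "\<forall>i<length cs.
      \<exists>u B v y. cs ! i = (u, B, v) \<and> ?x = u @ y @ v \<and> parse_tree G B y (s i)"
    by metis
  show ?case
    by (rule exI, rule parse_tree.Conj[OF r, of "map s [0..<length cs]"]) (use s in auto)
qed

lemma parse_tree_root:
  "parse_tree G A y s \<Longrightarrow> root_label s = A \<and> leaves s = y"
  by (cases rule: parse_tree.cases) auto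

text \<open>This locates the leaves of a subtree within the whole input, which the lookahead at
  \<open>p\<close> refers to.\<close>

lemma subtree_parse_tree:
  assumes "subtree_at t p s" and "parse_tree G A w t"
  shows "\<exists>B y z. parse_tree G B y s \<and> p \<le> length w \<and> drop p w = y @ z"
  using assms
proof (induction rule: subtree_at.induct)
  case root
  then show ?case by (metis append_Nil2 drop0 le0)
next
  case (child p w' A' cs ts i u B v)
  then obtain A'' y z where *: "parse_tree G A'' y (Node w' (Conj A' cs) ts)"
    "p \<le> length w" "drop p w = y @ z" by blast
  from *(1) child(2,4) obtain y' where y': "y = u @ y' @ v" "parse_tree G B y' (ts ! i)"
    by (cases rule: parse_tree.cases) fastforce
  have "drop (p + length u) w = drop (length u) (drop p w)" by (simp add: add.commute)
  then have "drop (p + length u) w = y' @ v @ z" using *(3) y'(1) by simp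
  moreover have "p + length u \<le> length w"
    using arg_cong[OF *(3), of length] *(2) y'(1) by simp
  ultimately show ?case using y'(2) by blast
qed

text \<open>The table is known to be right only for subtrees of a parse tree of the whole input,
  since the lookahead may extend beyond the subtree. Hence the tree \<open>t\<close> stays fixed,
  and the induction runs over its subtrees together with their positions.\<close>

lemma parse_tree_der:
  assumes t: "parse_tree G (start G) w t"
  shows "parse_tree G A y s \<Longrightarrow> subtree_at t p s \<Longrightarrow> der w A p (p + length y)"
proof (induction arbitrary: p rule: parse_tree.induct)
  case (Word A y)
  have "T (A, take k (drop p w)) = Some (Word A y)"
    using table t Word.prems unfolding LL_table_def by fastforce
  moreover from subtree_parse_tree[OF Word.prems t] parse_tree_root
  obtain z where "p \<le> length w" "drop p w = y @ z" by fastforce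
  ultimately show ?case by (intro der.word) (auto simp: matches_iff)
next
  case (Conj A cs ts y)
  have T: "T (A, take k (drop p w)) = Some (Conj A cs)"
    using table t Conj.prems unfolding LL_table_def by fastforce
  from subtree_parse_tree[OF Conj.prems t] parse_tree_root
  obtain z where p: "p \<le> length w" and z: "drop p w = y @ z" by fastforce
  show ?case
  proof (rule der.conj[OF p T], safe)
    fix u B v assume "(u, B, v) \<in> set cs"
    then obtain i where i: "i < length cs" "cs ! i = (u, B, v)" by (metis in_set_conv_nth)
    with Conj(3) obtain y' where y': "y = u @ y' @ v" "parse_tree G B y' (ts ! i)"
      and IH: "\<And>p. subtree_at t p (ts ! i) \<Longrightarrow> der w B p (p + length y')" by fastforce
    have "subtree_at t (p + length u) (ts ! i)"
      using subtree_at.child[OF Conj.prems i(1) _ i(2)] i Conj(2) by simp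
    then have "der w B (p + length u) (p + length u + length y')" by (rule IH)
    moreover have "matches w p u" using z y' by (simp add: matches_iff)
    moreover have "drop (p + length u + length y') w = drop (length u + length y') (drop p w)"
      by (simp add: add.commute add.left_commute)
    then have "matches w (p + length u + length y') v" using z y' by (simp add: matches_iff)
    ultimately show "\<exists>q'. matches w p u \<and> der w B (p + length u) q' \<and> matches w q' v \<and>
        p + length y = q' + length v"
      using y'(1) by (intro exI[of _ "p + length u + length y'"]) simp
  qed
qed

lemma language_iff_der:
  assumes "w \<in> lists (alphabet G)"
  shows "w \<in> language G \<longleftrightarrow> der w (start G) 0 (length w)"
proof
  assume "w \<in> language G"
  then obtain t where "parse_tree G (start G) w t" by (auto simp: language_def language_of_def)
  from parse_tree_der[OF this this subtree_at.root] show "der w (start G) 0 (length w)" by simp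
next
  assume "der w (start G) 0 (length w)"
  from der_parse_tree[OF this] show "w \<in> language G"
    using assms by (auto simp: language_def language_of_def)
qed


section \<open>The sweep from right to left\<close>

text \<open>
  \<open>f A d\<close> stands for the end of the derivation from \<open>A\<close> at the current position plus \<open>d\<close>,
  increased by one, with \<open>0\<close> if there is none or if none has been found yet. All conjuncts of
  a rule must end at the same position: the argument \<open>c\<close> of \<open>eval_conjs\<close> is this end, increased by
  one, according to the conjuncts seen so far, with \<open>0\<close> if there were none.
\<close>

definition sound where
  "sound w p f \<longleftrightarrow> (\<forall>A\<in>N. \<forall>d\<le>D. \<forall>q. f A d = Suc q \<longrightarrow> der w A (p + d) q)"

definition exact where
  "exact w p f \<longleftrightarrow> (\<forall>A\<in>N. \<forall>d\<le>D. \<forall>q. f A d = Suc q \<longleftrightarrow> der w A (p + d) q)"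

primrec eval_conjs ::
    "'a list \<Rightarrow> ('n \<Rightarrow> nat \<Rightarrow> nat) \<Rightarrow> nat \<Rightarrow> nat \<Rightarrow> ('a list \<times> 'n \<times> 'a list) list \<Rightarrow> nat" where
  "eval_conjs w f p c [] = c"
| "eval_conjs w f p c (t # cs) = (case t of (u, B, v) \<Rightarrow>
     if matches w p u \<and> f B (length u) \<noteq> 0 \<and> matches w (f B (length u) - 1) v \<and>
       (c = 0 \<or> c = f B (length u) + length v)
     then eval_conjs w f p (f B (length u) + length v) cs else 0)"

primrec eval_rule :: "'a list \<Rightarrow> ('n \<Rightarrow> nat \<Rightarrow> nat) \<Rightarrow> nat \<Rightarrow> ('a, 'n) rule \<Rightarrow> nat" where
  "eval_rule w f p (Word A y) = (if matches w p y then Suc (p + length y) else 0)"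
| "eval_rule w f p (Conj A cs) = eval_conjs w f p 0 cs"

fun apply_entry ::
    "'a list \<Rightarrow> nat \<Rightarrow> 'n \<times> 'a list \<times> ('a, 'n) rule \<Rightarrow> ('n \<Rightarrow> nat \<Rightarrow> nat) \<Rightarrow> 'n \<Rightarrow> nat \<Rightarrow> nat" where
  "apply_entry w p (A, x, r) f =
     (if f A 0 = 0 \<and> take k (drop p w) = x then f(A := (f A)(0 := eval_rule w f p r)) else f)"

definition shift :: "('n \<Rightarrow> nat \<Rightarrow> nat) \<Rightarrow> 'n \<Rightarrow> nat \<Rightarrow> nat" where
  "shift f A d = (if d = 0 then 0 else f A (d - 1))"

text \<open>
  Rules with a conjunct starting with a nonterminal refer to other derivations at the same
  position. Since each round that changes anything finds a derivation from another nonterminal,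
  \<open>Suc (card N)\<close> rounds always reach a fixed point.
\<close>

definition rounds where
  "rounds = concat (replicate (Suc (card N)) es)"

text \<open>Each conjunct replaces \<open>c\<close> by its own end after comparing the two, so
  equality of neighbours propagates to all conjuncts. As \<open>f\<close> stores ends increased by
  one, \<open>f B (length u) + length v\<close> is already the increased end of the
  conjunct.\<close>

lemma eval_conjs_Suc_iff:
  "eval_conjs w f p c cs = Suc q \<longleftrightarrow>
     (cs \<noteq> [] \<or> c = Suc q) \<and> (c = 0 \<or> c = Suc q) \<and>
     (\<forall>(u, B, v) \<in> set cs. matches w p u \<and> f B (length u) \<noteq> 0 \<and>
        matches w (f B (length u) - 1) v \<and> f B (length u) + length v = Suc q)"
proof (induction cs arbitrary: c)
  case (Cons t cs)
  obtain u B v where t: "t = (u, B, v)" by (metis prod_cases3)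
  let ?ok = "matches w p u \<and> f B (length u) \<noteq> 0 \<and> matches w (f B (length u) - 1) v"
  show ?case
  proof (cases "?ok \<and> (c = 0 \<or> c = f B (length u) + length v)")
    case True
    then have "eval_conjs w f p c (t # cs) = eval_conjs w f p (f B (length u) + length v) cs"
      by (simp add: t)
    then show ?thesis using True Cons.IH[of "f B (length u) + length v"] t by auto
  next
    case False
    then have "eval_conjs w f p c (t # cs) = 0" unfolding t by auto
    then show ?thesis using False t by auto
  qed
qed auto

lemma sound_apply_entry:
  assumes f: "sound w p f" and p: "p \<le> length w" and e: "e \<in> set es"
  shows "sound w p (apply_entry w p e f)"
proof -
  obtain A x r where [simp]: "e = (A, x, r)" by (metis prod_cases3)
  have r: "T (A, x) = Some r" "lhs r = A" "r \<in> rules G" using e es entryD by auto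
  have "der w A p q" if x: "take k (drop p w) = x" and q: "eval_rule w f p r = Suc q" for q
  proof (cases r)
    case (Word A' y)
    then show ?thesis using q r p x der.word[of p w A y] by (auto split: if_splits)
  next
    case (Conj A' cs)
    show ?thesis
    proof (rule der.conj[OF p])
      show "T (A, take k (drop p w)) = Some (Conj A cs)" using r Conj x by auto
      show "\<forall>(u, B, v)\<in>set cs. \<exists>q'. matches w p u \<and> der w B (p + length u) q' \<and>
          matches w q' v \<and> q = q' + length v"
      proof safe
        fix u B v assume c: "(u, B, v) \<in> set cs"
        with q Conj have *: "matches w p u" "f B (length u) \<noteq> 0"
          "matches w (f B (length u) - 1) v" "f B (length u) + length v = Suc q"
          by (auto simp: eval_conjs_Suc_iff)
        moreover have "B \<in> N" "length u \<le> D" using c Conj r conj_ruleD(2) D by auto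
        ultimately have "der w B (p + length u) (f B (length u) - 1)"
          using f unfolding sound_def by simp
        with * show "\<exists>q'. matches w p u \<and> der w B (p + length u) q' \<and>
            matches w q' v \<and> q = q' + length v"
          by (intro exI[of _ "f B (length u) - 1"]) auto
      qed
    qed
  qed
  then have new: "eval_rule w f p r = Suc q \<Longrightarrow> take k (drop p w) = x \<Longrightarrow> der w A (p + 0) q" for q
    by simp
  show ?thesis
  proof (cases "f A 0 = 0 \<and> take k (drop p w) = x")
    case True
    then have "apply_entry w p e f = f(A := (f A)(0 := eval_rule w f p r))" by simp
    moreover have "sound w p (f(A := (f A)(0 := eval_rule w f p r)))"
      unfolding sound_def
    proof (intro ballI allI impI)
      fix B d q assume "B \<in> N" "d \<le> D" "(f(A := (f A)(0 := eval_rule w f p r))) B d = Suc q"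
      then show "der w B (p + d) q"
        using f new[of q] True unfolding sound_def by (cases "B = A \<and> d = 0") (auto split: if_splits)
    qed
    ultimately show ?thesis by simp
  next
    case False
    then have "apply_entry w p e f = f" by auto
    with f show ?thesis by simp
  qed
qed

lemma sound_fold:
  assumes "sound w p f" and "p \<le> length w" and "set es' \<subseteq> set es"
  shows "sound w p (fold (apply_entry w p) es' f)"
  using assms(1,3) by (induction es' arbitrary: f) (auto intro: sound_apply_entry assms(2))

lemma apply_entry_positive: "d \<noteq> 0 \<Longrightarrow> apply_entry w p e f A d = f A d"
  by (cases e) auto

lemma fold_positive: "d \<noteq> 0 \<Longrightarrow> fold (apply_entry w p) es' f A d = f A d"
  by (induction es' arbitrary: f) (auto simp: apply_entry_positive)

text \<open>Induction on the derivation: a conjunct with empty \<open>u\<close> is covered by the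
  induction hypothesis and one with nonempty \<open>u\<close> by \<open>pos\<close>. The rule can
  therefore be evaluated, and stationarity forces a nonzero value at \<open>f A 0\<close>.\<close>

lemma exact_fixpoint:
  assumes f: "sound w p f"
    and pos: "\<And>A d q. A \<in> N \<Longrightarrow> 0 < d \<Longrightarrow> d \<le> D \<Longrightarrow> der w A (p + d) q \<Longrightarrow> f A d = Suc q"
    and fix_f: "\<And>e. e \<in> set es \<Longrightarrow> apply_entry w p e f = f"
  shows "exact w p f"
proof -
  have zero: "der w A p' q \<Longrightarrow> p' = p \<Longrightarrow> f A 0 = Suc q" for A p' q
  proof (induction rule: der.induct)
    case (word p' A y)
    let ?e = "(A, take k (drop p w), Word A y)"
    have "?e \<in> set es" using word es by auto
    from fix_f[OF this] have "apply_entry w p ?e f A 0 = f A 0" by simp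
    \<comment> \<open>An entry writes whenever it finds \<open>0\<close>, and it changes nothing
      here. In either case \<open>f A 0\<close> is nonzero, so soundness and uniqueness of ends give
      its value.\<close>
    then have "f A 0 \<noteq> 0 \<or> f A 0 = Suc (p + length y)"
      using word by (cases "f A 0 = 0") auto
    moreover have "A \<in> N" using entryD word by blast
    moreover have "der w A p (p + length y)" using word der.word by blast
    ultimately show ?case using f der_unique word
      unfolding sound_def by (metis add.right_neutral le0 not0_implies_Suc)
  next
    case (conj p' A cs q)
    let ?e = "(A, take k (drop p w), Conj A cs)"
    have r: "Conj A cs \<in> rules G" "A \<in> N" using entryD conj by blast+
    have "matches w p u \<and> f B (length u) \<noteq> 0 \<and>
        matches w (f B (length u) - 1) v \<and> f B (length u) + length v = Suc q"
      if c: "(u, B, v) \<in> set cs" for u B v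
    proof -
      from conj(3,4) c obtain q' where q': "matches w p u" "der w B (p + length u) q'"
        "matches w q' v" "q = q' + length v" "u = [] \<longrightarrow> f B 0 = Suc q'" by fastforce
      have "f B (length u) = Suc q'"
        using pos[OF conj_ruleD(2)[OF r(1) c] _ D[OF r(1) c] q'(2)] q'(5) by (cases u) auto
      then show ?thesis using q' by simp
    qed
    then have "eval_rule w f p (Conj A cs) = Suc q"
      using conj_ruleD(1)[OF r(1)] by (auto simp: eval_conjs_Suc_iff)
    moreover have "?e \<in> set es" using conj es by auto
    from fix_f[OF this] have "apply_entry w p ?e f A 0 = f A 0" by simp
    then have "f A 0 \<noteq> 0 \<or> f A 0 = eval_rule w f p (Conj A cs)"
      by (cases "f A 0 = 0") auto
    moreover have "der w A p q" using conj der.conj[of p w A cs q] by fast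
    ultimately show ?case using f der_unique r(2)
      unfolding sound_def by (metis add.right_neutral le0 not0_implies_Suc)
  qed
  show ?thesis
    unfolding exact_def
  proof (intro ballI allI impI iffI)
    fix A d q assume "A \<in> N" "d \<le> D" "der w A (p + d) q"
    then show "f A d = Suc q" using zero pos by (cases "d = 0") auto
  qed (use f in \<open>auto simp: sound_def\<close>)
qed

end

text \<open>The potential \<phi> prevents changes made within one pass from cancelling out: a pass
  without net effect consists of steps that are all without effect.\<close>

lemma fold_stationary:
  fixes \<phi> :: "'b \<Rightarrow> nat"
  assumes "\<And>e x. e \<in> set es \<Longrightarrow> g e x = x \<or> \<phi> x < \<phi> (g e x)"
  shows "(\<forall>e\<in>set es. g e x = x) \<and> fold g es x = x \<or> \<phi> x < \<phi> (fold g es x)"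
  using assms
proof (induction es arbitrary: x)
  case (Cons e es)
  have IH: "(\<forall>e\<in>set es. g e (g e' x) = g e' x) \<and> fold g es (g e' x) = g e' x \<or>
      \<phi> (g e' x) < \<phi> (fold g es (g e' x))" for e'
    by (rule Cons.IH) (use Cons.prems in simp)
  from Cons.prems[of e x] IH[of e] show ?case by force
qed simp

lemma funpow_stationary:
  fixes \<phi> :: "'b \<Rightarrow> nat"
  assumes "\<And>x. F x = x \<or> \<phi> x < \<phi> (F x)" and "\<And>x. \<phi> x \<le> m"
  shows "F ((F ^^ Suc m) x) = (F ^^ Suc m) x"
proof -
  \<comment> \<open>As long as the iteration moves, each application raises the potential by at
    least one; \<open>i = Suc m\<close> would exceed its maximum.\<close>
  have "F ((F ^^ i) x) = (F ^^ i) x \<or> i \<le> \<phi> ((F ^^ i) x)" for i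
  proof (induction i)
    case (Suc i)
    then show ?case using assms(1)[of "(F ^^ i) x"] by auto
  qed simp
  from this[of "Suc m"] assms(2)[of "(F ^^ Suc m) x"] show ?thesis by auto
qed

lemma fold_concat_replicate: "fold g (concat (replicate m xs)) = fold g xs ^^ m"
  by (induction m) (auto simp: funpow_swap1 fun_eq_iff)

context ll_recognizer
begin

lemma finite_N: "finite N"
  using lin by (simp add: linear_conjunctive_grammar_def)

text \<open>Only a zero is ever overwritten, so the set of nonterminals with a known end never
  shrinks; writing zero over zero changes nothing.\<close>

lemma apply_entry_progress:
  assumes "e \<in> set es"
  shows "apply_entry w p e f = f \<or>
    card {A \<in> N. f A 0 \<noteq> 0} < card {A \<in> N. apply_entry w p e f A 0 \<noteq> 0}"
proof -
  obtain A x r where [simp]: "e = (A, x, r)" by (metis prod_cases3)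
  have A: "A \<in> N" using assms es entryD by auto
  consider "apply_entry w p e f = f"
    | "f A 0 = 0" "apply_entry w p e f = f(A := (f A)(0 := eval_rule w f p r))"
      "eval_rule w f p r \<noteq> 0"
    by (cases "f A 0 = 0 \<and> take k (drop p w) = x \<and> eval_rule w f p r \<noteq> 0")
       (auto simp: fun_eq_iff)
  then show ?thesis
  proof cases
    case 2
    have "A \<in> {B \<in> N. apply_entry w p e f B 0 \<noteq> 0} - {B \<in> N. f B 0 \<noteq> 0}"
      unfolding 2(2) using 2 A by simp
    moreover have "{B \<in> N. f B 0 \<noteq> 0} \<subseteq> {B \<in> N. apply_entry w p e f B 0 \<noteq> 0}"
      unfolding 2(2) using 2 by auto
    ultimately have "{B \<in> N. f B 0 \<noteq> 0} \<subset> {B \<in> N. apply_entry w p e f B 0 \<noteq> 0}" by blast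
    then show ?thesis using finite_N by (simp add: psubset_card_mono)
  qed simp
qed

text \<open>For \<open>d > 0\<close> the values are those of position \<open>Suc p\<close>, shifted
  and then left alone by all entries; those for \<open>d = 0\<close> are exact because the rounds
  reach a fixed point.\<close>

lemma exact_rounds:
  assumes f: "exact w (Suc p) f" and p: "p \<le> length w"
  shows "exact w p (fold (apply_entry w p) rounds (shift f))"
proof -
  let ?F = "fold (apply_entry w p) es" and ?g = "fold (apply_entry w p) rounds (shift f)"
  define \<phi> where "\<phi> f = card {A \<in> N. f A 0 \<noteq> 0}" for f :: "'n \<Rightarrow> nat \<Rightarrow> nat"
  have stat: "(\<forall>e\<in>set es. apply_entry w p e g = g) \<and> ?F g = g \<or> \<phi> g < \<phi> (?F g)" for g
    unfolding \<phi>_def by (rule fold_stationary) (rule apply_entry_progress)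
  have "?F ?g = ?g"
    unfolding rounds_def fold_concat_replicate
  proof (rule funpow_stationary[where \<phi> = \<phi>])
    show "\<phi> g \<le> card N" for g unfolding \<phi>_def using finite_N by (auto intro: card_mono)
  qed (use stat in blast)
  with stat[of ?g] have fix_g: "\<forall>e\<in>set es. apply_entry w p e ?g = ?g" by simp
  have "sound w p (shift f)"
    using f unfolding sound_def exact_def shift_def
    by (auto simp: gr0_conv_Suc split: if_splits)
  then have "sound w p ?g" using p by (rule sound_fold) (auto simp: rounds_def)
  then show ?thesis
  proof (rule exact_fixpoint)
    fix A d q assume "A \<in> N" "0 < d" "d \<le> D" "der w A (p + d) q"
    then show "?g A d = Suc q"
      using f unfolding exact_def by (auto simp: fold_positive shift_def gr0_conv_Suc)
  qed (use fix_g in blast)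
qed


section \<open>The code of the sweep\<close>

text \<open>
  Register \<open>0\<close> holds the constant \<open>1\<close>, register \<open>2\<close> the current position, and the registers
  \<open>3\<close>, \<open>4\<close> and \<open>5\<close> are temporary, with \<open>5\<close> holding the argument \<open>c\<close> of \<open>eval_conjs\<close>.
\<close>

definition ev :: "'n \<Rightarrow> nat \<Rightarrow> nat" where
  "ev A d = prod_encode (idx A, d) + 6"

lemma ev_eq_iff: "A \<in> N \<Longrightarrow> B \<in> N \<Longrightarrow> ev A d = ev B e \<longleftrightarrow> A = B \<and> d = e"
  using idx by (auto simp: ev_def inj_on_def)

lemma ev_neq [simp]:
  "ev A d \<noteq> 0" "ev A d \<noteq> 2" "ev A d \<noteq> 3" "ev A d \<noteq> 4" "ev A d \<noteq> 5" "0 < ev A d"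
  "2 \<noteq> ev A d" "3 \<noteq> ev A d" "4 \<noteq> ev A d" "5 \<noteq> ev A d"
  by (auto simp: ev_def)

text \<open>The last clause makes it possible to bound all registers, and not only the named
  ones.\<close>

definition stores :: "(nat \<Rightarrow> nat) \<Rightarrow> nat \<Rightarrow> ('n \<Rightarrow> nat \<Rightarrow> nat) \<Rightarrow> bool" where
  "stores R p f \<longleftrightarrow> R 0 = 1 \<and> R 2 = p \<and> (\<forall>A\<in>N. \<forall>d\<le>D. R (ev A d) = f A d) \<and>
     (\<forall>r. r \<notin> {0, 2, 3, 4, 5} \<union> {ev A d | A d. A \<in> N \<and> d \<le> D} \<longrightarrow> R r = 0)"

lemma storesD:
  assumes "stores R p f"
  shows "R 0 = 1" "R 2 = p" "A \<in> N \<Longrightarrow> d \<le> D \<Longrightarrow> R (ev A d) = f A d"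
  using assms by (auto simp: stores_def)

lemma stores_tmp [simp]:
  "stores (R(3 := x)) p f \<longleftrightarrow> stores R p f"
  "stores (R(4 := x)) p f \<longleftrightarrow> stores R p f"
  "stores (R(5 := x)) p f \<longleftrightarrow> stores R p f"
  by (auto simp: stores_def)

lemma stores_ev:
  "stores R p f \<Longrightarrow> A \<in> N \<Longrightarrow> stores (R(ev A 0 := x)) p (f(A := (f A)(0 := x)))"
  by (auto simp: stores_def ev_eq_iff)

primrec match_code :: "'a list \<Rightarrow> 'a stmt \<Rightarrow> 'a stmt" where
  "match_code [] s = s"
| "match_code (a # u) s = IfSymbol 3 (Some a) (Seq (SAdd 3 3 0) (match_code u s)) Skip"

lemma sem_match_code:
  "R 0 = 1 \<Longrightarrow> matches w (R 3) u \<Longrightarrow>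
     sem w (match_code u s) R = sem w s (R(3 := R 3 + length u))"
  by (induction u arbitrary: R) auto

lemma sem_match_code_fail:
  "R 0 = 1 \<Longrightarrow> \<not> matches w (R 3) u \<Longrightarrow> \<exists>x. sem w (match_code u s) R = R(3 := x)"
proof (induction u arbitrary: R)
  case (Cons a u)
  show ?case
  proof (cases "input_symbol w (R 3) = Some a")
    case True
    have "\<exists>x. sem w (match_code u s) (R(3 := Suc (R 3))) = R(3 := Suc (R 3), 3 := x)"
      by (rule Cons.IH) (use True Cons.prems in auto)
    with True Cons.prems show ?thesis by (simp del: fun_upd_apply add: fun_upd_same)
  next
    case False
    then have "sem w (match_code (a # u) s) R = R(3 := R 3)" by simp
    then show ?thesis ..
  qed
qed simp

text \<open>The stored end is decreased by one to obtain the position where \<open>v\<close> must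
  start, and increased again afterwards. Equality of registers \<open>3\<close> and \<open>5\<close>
  is tested by two truncated subtractions, which are both zero only for equal numbers. The
  continuation \<open>s\<close> is the code for the remaining conjuncts.\<close>

fun conj_code :: "'a list \<times> 'n \<times> 'a list \<Rightarrow> 'a stmt \<Rightarrow> 'a stmt" where
  "conj_code (u, B, v) s =
     Seq (SCopy 3 2) (match_code u
       (IfZero (ev B (length u)) Skip
         (Seq (SSub 3 (ev B (length u)) 0) (match_code v
           (Seq (SAdd 3 3 0)
             (IfZero 5 (Seq (SCopy 5 3) s)
               (Seq (SSub 4 3 5) (IfZero 4
                 (Seq (SSub 4 5 3) (IfZero 4 s Skip)) Skip))))))))"

primrec rule_code :: "('a, 'n) rule \<Rightarrow> 'a stmt" where
  "rule_code (Word A y) = Seq (SCopy 3 2) (match_code y (SAdd (ev A 0) 3 0))"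
| "rule_code (Conj A cs) = Seq (SConst 5 0) (foldr conj_code cs (SCopy (ev A 0) 5))"

text \<open>The lookahead test follows \<open>lookahead_iff\<close>: after the comparison with
  \<open>x\<close>, register \<open>3\<close> points just behind it.\<close>

fun entry_code :: "'n \<times> 'a list \<times> ('a, 'n) rule \<Rightarrow> 'a stmt" where
  "entry_code (A, x, r) = IfZero (ev A 0)
     (Seq (SCopy 3 2) (match_code x
       (if length x = k then rule_code r else IfSymbol 3 None (rule_code r) Skip))) Skip"

lemma sem_conj_code:
  assumes R: "stores R p f" and B: "B \<in> N" and u: "length u \<le> D"
  shows "if matches w p u \<and> f B (length u) \<noteq> 0 \<and> matches w (f B (length u) - 1) v \<and>
      (R 5 = 0 \<or> R 5 = f B (length u) + length v)
    then \<exists>R'. sem w (conj_code (u, B, v) s) R = sem w s R' \<and> stores R' p f \<and>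
      R' 5 = f B (length u) + length v
    else stores (sem w (conj_code (u, B, v) s) R) p f"
proof -
  note st = storesD[OF R]
  let ?c = "f B (length u)"
  let ?s3 = "Seq (SAdd 3 3 0) (IfZero 5 (Seq (SCopy 5 3) s)
    (Seq (SSub 4 3 5) (IfZero 4 (Seq (SSub 4 5 3) (IfZero 4 s Skip)) Skip)))"
  let ?s2 = "match_code v ?s3"
  let ?s1 = "IfZero (ev B (length u)) Skip (Seq (SSub 3 (ev B (length u)) 0) ?s2)"
  have 0: "sem w (conj_code (u, B, v) s) R = sem w (match_code u ?s1) (R(3 := p))"
    using st by simp
  show ?thesis
  proof (cases "matches w p u")
    case False
    with sem_match_code_fail[of "R(3 := p)" w u ?s1] st obtain x where
      "sem w (match_code u ?s1) (R(3 := p)) = R(3 := x)" by auto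
    with 0 False R show ?thesis by simp
  next
    case True
    then have 1: "sem w (conj_code (u, B, v) s) R = sem w ?s1 (R(3 := p + length u))"
      using 0 sem_match_code[of "R(3 := p)" w u ?s1] st by simp
    show ?thesis
    proof (cases "?c = 0")
      case True
      with 1 R st(3)[OF B u] show ?thesis by simp
    next
      case False
      then have 2: "sem w (conj_code (u, B, v) s) R = sem w ?s2 (R(3 := ?c - 1))"
        using 1 st(1) st(3)[OF B u] by simp
      show ?thesis
      proof (cases "matches w (?c - 1) v")
        case False
        with sem_match_code_fail[of "R(3 := ?c - 1)" w v ?s3] st obtain x where
          "sem w ?s2 (R(3 := ?c - 1)) = R(3 := x)" by auto
        with 2 False R show ?thesis by simp
      next
        case True
        then have 3: "sem w (conj_code (u, B, v) s) R = sem w ?s3 (R(3 := ?c - 1 + length v))"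
          using 2 sem_match_code[of "R(3 := ?c - 1)" w v ?s3] st by simp
        let ?R = "R(3 := ?c + length v)"
        have 4: "sem w (conj_code (u, B, v) s) R =
            (if R 5 = 0 then sem w s (?R(5 := ?c + length v))
             else if ?c + length v \<le> R 5 then
               (if R 5 \<le> ?c + length v then sem w s (?R(4 := 0)) else ?R(4 := R 5 - (?c + length v)))
             else ?R(4 := ?c + length v - R 5))"
          unfolding 3 using st(1) \<open>?c \<noteq> 0\<close> by simp
        consider "R 5 = 0" | "R 5 = ?c + length v" | "R 5 \<noteq> 0" "R 5 \<noteq> ?c + length v"
          by blast
        then show ?thesis
        proof cases
          case 1
          then show ?thesis using 4 True \<open>matches w p u\<close> \<open>?c \<noteq> 0\<close> R
            by (auto intro!: exI[of _ "?R(5 := ?c + length v)"])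
        next
          case 2
          then show ?thesis using 4 True \<open>matches w p u\<close> \<open>?c \<noteq> 0\<close> R
            by (auto intro!: exI[of _ "?R(4 := 0)"])
        next
          case 3
          then show ?thesis using 4 R by auto
        qed
      qed
    qed
  qed
qed

lemma stores_conjs_code:
  assumes "stores R p f" and "A \<in> N" and "f A 0 = 0"
    and "\<forall>(u, B, v) \<in> set cs. B \<in> N \<and> length u \<le> D"
  shows "stores (sem w (foldr conj_code cs (SCopy (ev A 0) 5)) R) p
    (f(A := (f A)(0 := eval_conjs w f p (R 5) cs)))"
  using assms(1,4)
proof (induction cs arbitrary: R)
  case Nil
  then show ?case using stores_ev[OF _ assms(2)] by (simp del: fun_upd_apply)
next
  case (Cons t cs)
  obtain u B v where [simp]: "t = (u, B, v)" by (metis prod_cases3)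
  \<comment> \<open>Code that fails writes nothing at all, which agrees with storing the result
    \<open>0\<close> only because \<open>f A 0\<close> is still \<open>0\<close>.\<close>
  have triv: "f(A := (f A)(0 := 0)) = f" using assms(3) by (auto simp: fun_eq_iff)
  let ?s = "foldr conj_code cs (SCopy (ev A 0) 5)"
  let ?ok = "matches w p u \<and> f B (length u) \<noteq> 0 \<and> matches w (f B (length u) - 1) v \<and>
      (R 5 = 0 \<or> R 5 = f B (length u) + length v)"
  have B: "B \<in> N" "length u \<le> D" using Cons.prems(2) by auto
  note conj = sem_conj_code[OF Cons.prems(1) B, of w v ?s]
  show ?case
  proof (cases ?ok)
    case True
    with conj obtain R' where R': "sem w (conj_code (u, B, v) ?s) R = sem w ?s R'"
      "stores R' p f" "R' 5 = f B (length u) + length v" unfolding if_P[OF True] by blast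
    have "eval_conjs w f p (R 5) (t # cs) = eval_conjs w f p (R' 5) cs"
      using True R'(3) by simp
    moreover have "sem w (foldr conj_code (t # cs) (SCopy (ev A 0) 5)) R = sem w ?s R'"
      using R'(1) by (simp del: conj_code.simps)
    ultimately show ?thesis using Cons.IH[OF R'(2)] Cons.prems(2) by (simp only:) simp
  next
    case False
    then have "eval_conjs w f p (R 5) (t # cs) = 0" by auto
    moreover have "stores (sem w (foldr conj_code (t # cs) (SCopy (ev A 0) 5)) R) p f"
      using conj unfolding if_not_P[OF False] by simp
    ultimately show ?thesis by (simp only: triv)
  qed
qed

lemma stores_rule_code:
  assumes R: "stores R p f" and r: "r \<in> rules G" and 0: "f (lhs r) 0 = 0"
    and A: "lhs r \<in> N"
  shows "stores (sem w (rule_code r) R) p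
    (f(lhs r := (f (lhs r))(0 := eval_rule w f p r)))"
proof (cases r)
  case (Word A y)
  note st = storesD[OF R]
  have triv: "f(A := (f A)(0 := 0)) = f" using 0 Word by (auto simp: fun_eq_iff)
  let ?s = "SAdd (ev A 0) 3 0"
  show ?thesis
  proof (cases "matches w p y")
    case True
    then have "sem w (rule_code r) R = (R(3 := p + length y))(ev A 0 := Suc (p + length y))"
      using Word st sem_match_code[of "R(3 := p)" w y ?s] by simp
    moreover have "stores \<dots> p (f(A := (f A)(0 := Suc (p + length y))))"
      using R A Word by (intro stores_ev) auto
    ultimately show ?thesis using True Word by simp
  next
    case False
    with sem_match_code_fail[of "R(3 := p)" w y ?s] st obtain x where
      "sem w (match_code y ?s) (R(3 := p)) = R(3 := x)" by auto
    then show ?thesis using False Word R st triv by simp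
  qed
next
  case (Conj A cs)
  have "\<forall>(u, B, v) \<in> set cs. B \<in> N \<and> length u \<le> D"
    using r Conj conj_ruleD(2) D by blast
  from stores_conjs_code[OF _ _ _ this, of "R(5 := 0)" p f A w] show ?thesis
    using R 0 A Conj by simp
qed

lemma stores_entry_code:
  assumes R: "stores R p f" and e: "e \<in> set es"
  shows "stores (sem w (entry_code e) R) p (apply_entry w p e f)"
proof -
  obtain A x r where e_eq: "e = (A, x, r)" by (metis prod_cases3)
  have r: "lhs r = A" "r \<in> rules G" "A \<in> N" "length x \<le> k" using e es entryD e_eq by auto
  note st = storesD[OF R]
  let ?s = "if length x = k then rule_code r else IfSymbol 3 None (rule_code r) Skip"
  show ?thesis
  proof (cases "f A 0 = 0")
    case True
    then have 1: "sem w (entry_code e) R = sem w (match_code x ?s) (R(3 := p))"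
      using st e_eq r(3) by simp
    show ?thesis
    proof (cases "matches w p x")
      case False
      with sem_match_code_fail[of "R(3 := p)" w x ?s] st obtain y where
        "sem w (match_code x ?s) (R(3 := p)) = R(3 := y)" by auto
      moreover have "take k (drop p w) \<noteq> x" using False by (auto simp: lookahead_iff)
      ultimately show ?thesis using 1 R e_eq by simp
    next
      case m: True
      let ?R = "R(3 := p + length x)"
      from m have 2: "sem w (entry_code e) R = sem w ?s ?R"
        using 1 sem_match_code[of "R(3 := p)" w x ?s] st by simp
      show ?thesis
      proof (cases "length x = k \<or> input_symbol w (p + length x) = None")
        case l: True
        then have "take k (drop p w) = x" using m r(4) by (simp add: lookahead_iff)
        then have 3: "apply_entry w p e f = f(A := (f A)(0 := eval_rule w f p r))"
          using True e_eq by simp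
        have 4: "sem w (entry_code e) R = sem w (rule_code r) ?R" unfolding 2 using l by auto
        have "stores ?R p f" using R by simp
        from stores_rule_code[OF this r(2), of w] show ?thesis
          unfolding 3 4 using r(1,3) True by simp
      next
        case False
        then have "take k (drop p w) \<noteq> x" by (simp add: lookahead_iff)
        then have 3: "apply_entry w p e f = f" using e_eq by simp
        show ?thesis unfolding 2 3 using False R by auto
      qed
    qed
  next
    case False
    then show ?thesis using st r R e_eq by simp
  qed
qed

text \<open>The copies proceed from the largest offset downwards, so that each value is moved before
  it is overwritten.\<close>

primrec shift_code :: "'n \<Rightarrow> nat \<Rightarrow> 'a stmt" where
  "shift_code A 0 = SConst (ev A 0) 0"
| "shift_code A (Suc d) = Seq (SCopy (ev A (Suc d)) (ev A d)) (shift_code A d)"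

lemma sem_shift_code_other: "\<forall>e\<le>d. r \<noteq> ev A e \<Longrightarrow> sem w (shift_code A d) R r = R r"
  by (induction d arbitrary: R) auto

lemma sem_shift_code:
  assumes "A \<in> N"
  shows "e \<le> d \<Longrightarrow> sem w (shift_code A d) R (ev A e) = (if e = 0 then 0 else R (ev A (e - 1)))"
proof (induction d arbitrary: R)
  case (Suc d)
  show ?case
  proof (cases "e \<le> d")
    case True
    then show ?thesis using Suc assms by (auto simp: ev_eq_iff)
  next
    case False
    then have "e = Suc d" using Suc by simp
    then show ?thesis using assms by (simp add: sem_shift_code_other ev_eq_iff)
  qed
qed (use assms in simp)

lemma stores_shift_code:
  assumes R: "stores R p f" and A: "A \<in> N"
  shows "stores (sem w (shift_code A D) R) p (f(A := shift f A))"
proof -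
  have other: "sem w (shift_code A D) R r = R r" if "\<forall>e\<le>D. r \<noteq> ev A e" for r
    using that by (rule sem_shift_code_other)
  have "sem w (shift_code A D) R r = R r"
    if "r \<notin> {ev A d | A d. A \<in> N \<and> d \<le> D}" for r
    by (rule other) (use that A in auto)
  moreover have "sem w (shift_code A D) R (ev B d) = R (ev B d)" if "B \<in> N" "B \<noteq> A" for B d
    by (rule other) (use that A in \<open>auto simp: ev_eq_iff\<close>)
  moreover have "sem w (shift_code A D) R (ev A d) = shift f A d" if "d \<le> D" for d
    using that R A by (simp add: sem_shift_code shift_def stores_def)
  ultimately show ?thesis
    using R A unfolding stores_def by (auto simp: other)
qed

lemma stores_shift_codes:
  assumes "stores R p f" and "distinct As" and "set As \<subseteq> N"
  shows "stores (sem w (foldr Seq (map (\<lambda>A. shift_code A D) As) Skip) R) p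
    (\<lambda>A. if A \<in> set As then shift f A else f A)"
  using assms
proof (induction As arbitrary: R f)
  case (Cons A As)
  let ?f = "f(A := shift f A)"
  have "stores (sem w (shift_code A D) R) p ?f" using Cons.prems by (auto intro: stores_shift_code)
  from Cons.IH[OF this] Cons.prems have
    "stores (sem w (foldr Seq (map (\<lambda>A. shift_code A D) As) Skip) (sem w (shift_code A D) R)) p
      (\<lambda>B. if B \<in> set As then shift ?f B else ?f B)" by simp
  moreover have "(\<lambda>B. if B \<in> set As then shift ?f B else ?f B) =
      (\<lambda>B. if B \<in> set (A # As) then shift f B else f B)"
    using Cons.prems by (auto simp: fun_eq_iff shift_def)
  ultimately show ?case by simp
qed simp

lemma stores_entry_codes:
  assumes "stores R p f" and "set es' \<subseteq> set es"
  shows "stores (sem w (foldr Seq (map entry_code es') Skip) R) p (fold (apply_entry w p) es' f)"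
  using assms
  by (induction es' arbitrary: R f) (auto simp: stores_entry_code simp del: entry_code.simps)

text \<open>Clearing the temporaries at the end makes the register bound hold for them at the start
  of each round of the loop.\<close>

definition body :: "'a stmt" where
  "body = Seq (foldr Seq (map (\<lambda>A. shift_code A D) Ns) Skip)
     (Seq (foldr Seq (map entry_code rounds) Skip)
       (Seq (SConst 3 0) (Seq (SConst 4 0) (SConst 5 0))))"

text \<open>Two positions are needed because register \<open>2\<close> is decreased before the
  window moves: on entry to \<open>body\<close> the window still belongs to
  \<open>p' = Suc p\<close>, afterwards to \<open>p' = p\<close>.\<close>

definition loop_state :: "'a list \<Rightarrow> nat \<Rightarrow> nat \<Rightarrow> (nat \<Rightarrow> nat) \<Rightarrow> bool" where
  "loop_state w p p' R \<longleftrightarrow>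
     (\<exists>f. stores R p f \<and> exact w p' f) \<and> R 3 = 0 \<and> R 4 = 0 \<and> R 5 = 0"

lemma loop_state_body:
  assumes R: "loop_state w p (Suc p) R" and p: "p \<le> length w"
  shows "loop_state w p p (sem w body R)"
proof -
  from R obtain f where f: "stores R p f" "exact w (Suc p) f" by (auto simp: loop_state_def)
  let ?R = "sem w (foldr Seq (map (\<lambda>A. shift_code A D) Ns) Skip) R"
  have "stores ?R p (\<lambda>A. if A \<in> N then shift f A else f A)"
    using stores_shift_codes[OF f(1) Ns(2)] Ns(1) by simp
  then have "stores ?R p (shift f)" unfolding stores_def by (simp cong: ball_cong)
  moreover have "set rounds \<subseteq> set es" by (auto simp: rounds_def)
  ultimately have "stores (sem w (foldr Seq (map entry_code rounds) Skip) ?R) p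
      (fold (apply_entry w p) rounds (shift f))"
    by (rule stores_entry_codes)
  then have "stores (sem w body R) p (fold (apply_entry w p) rounds (shift f))"
    unfolding body_def by simp
  with exact_rounds[OF f(2) p] have "\<exists>f. stores (sem w body R) p f \<and> exact w p f" by blast
  then show ?thesis unfolding loop_state_def by (simp add: body_def)
qed

text \<open>Derivations end within the input, so a stored end is at most
  \<open>length w + 1\<close>.\<close>

lemma loop_state_bound:
  assumes "loop_state w p p' R" and "p \<le> length w"
  shows "R r \<le> length w + 1"
proof -
  from assms obtain f where f: "stores R p f" "exact w p' f" "R 3 = 0" "R 4 = 0" "R 5 = 0"
    by (auto simp: loop_state_def)
  show ?thesis
  proof (cases "r \<in> {0, 2, 3, 4, 5} \<union> {ev A d | A d. A \<in> N \<and> d \<le> D}")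
    case True
    then consider "r \<in> {0, 2, 3, 4, 5}" | A d where "r = ev A d" "A \<in> N" "d \<le> D" by fast
    then show ?thesis
    proof cases
      case 1
      then show ?thesis using storesD(1,2)[OF f(1)] f(3-5) assms(2) by auto
    next
      case 2
      have "f A d \<le> length w + 1"
      proof (cases "f A d")
        case (Suc q)
        then have "der w A (p' + d) q" using f(2) 2(2,3) unfolding exact_def by blast
        from der_bounds[OF this] Suc show ?thesis by simp
      qed simp
      then show ?thesis using storesD(3)[OF f(1) 2(2,3)] 2(1) by simp
    qed
  next
    case False
    then have "R r = 0" using f(1) unfolding stores_def by blast
    then show ?thesis by simp
  qed
qed

text \<open>
  Ends never exceed the length of the input, so the final \<open>Test\<close> for a position past the
  last symbol recognizes a derivation of the whole input.
\<close>

definition program :: "'a instr list" where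
  "program = (let m = 4 + stmt_size body; e = ev (start G) 0 in
     [Const 0 1, Test 2 None 4, Add 2 2 0, Jump 1] @ code 4 body @
     [JumpZero 2 (m + 3), Sub 2 2 0, Jump 4,
      JumpZero e (m + 6), Sub e e 0, Test e None (m + 7), Reject, Accept])"

lemma program_nth:
  assumes "m = 4 + stmt_size body"
  shows "length program = m + 8"
    "program ! 0 = Const 0 1" "program ! 1 = Test 2 None 4"
    "program ! 2 = Add 2 2 0" "program ! 3 = Jump 1"
    "program ! m = JumpZero 2 (m + 3)" "program ! (m + 1) = Sub 2 2 0"
    "program ! (m + 2) = Jump 4" "program ! (m + 3) = JumpZero (ev (start G) 0) (m + 6)"
    "program ! (m + 4) = Sub (ev (start G) 0) (ev (start G) 0) 0"
    "program ! (m + 5) = Test (ev (start G) 0) None (m + 7)"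
    "program ! (m + 6) = Reject" "program ! (m + 7) = Accept"
proof -
  define pre :: "'a instr list" where
    "pre = [Const 0 1, Test 2 None 4, Add 2 2 0, Jump 1] @ code 4 body"
  define post :: "'a instr list" where
    "post = [JumpZero 2 (m + 3), Sub 2 2 0, Jump 4, JumpZero (ev (start G) 0) (m + 6),
      Sub (ev (start G) 0) (ev (start G) 0) 0, Test (ev (start G) 0) None (m + 7), Reject, Accept]"
  have program: "program = pre @ post" and m: "length pre = m"
    using assms by (simp_all add: program_def pre_def post_def Let_def)
  have "program ! (m + i) = post ! i" for i
    unfolding program m[symmetric] by simp
  from this[of 0] this[of 1] this[of 2] this[of 3] this[of 4] this[of 5] this[of 6] this[of 7]
  show "program ! m = JumpZero 2 (m + 3)" "program ! (m + 1) = Sub 2 2 0"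
    "program ! (m + 2) = Jump 4" "program ! (m + 3) = JumpZero (ev (start G) 0) (m + 6)"
    "program ! (m + 4) = Sub (ev (start G) 0) (ev (start G) 0) 0"
    "program ! (m + 5) = Test (ev (start G) 0) None (m + 7)"
    "program ! (m + 6) = Reject" "program ! (m + 7) = Accept"
    by (simp_all add: post_def)
  show "length program = m + 8" unfolding program by (simp add: m post_def)
  show "program ! 0 = Const 0 1" "program ! 1 = Test 2 None 4"
    "program ! 2 = Add 2 2 0" "program ! 3 = Jump 1"
    by (simp_all add: program_def Let_def)
qed

lemma code_at_body: "code_at program 4 (code 4 body)"
proof -
  define pre :: "'a instr list" where "pre = [Const 0 1, Test 2 None 4, Add 2 2 0, Jump 1]"
  obtain post where program: "program = pre @ code 4 body @ post"
    unfolding program_def pre_def Let_def by blast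
  have "length pre = 4" by (simp add: pre_def)
  with code_at_self[of pre "code 4 body @ post"] show ?thesis
    unfolding program code_at_append by simp
qed

section \<open>The run of the whole program\<close>

text \<open>The configurations at segment boundaries, each with a number that decreases along the
  run. The scan finds the length of the input and counts from \<open>2 * length w + 1\<close> down
  to \<open>length w + 1\<close>, which leaves \<open>length w\<close> down to \<open>0\<close> for
  the sweep.\<close>

inductive head :: "'a list \<Rightarrow> nat \<Rightarrow> config \<Rightarrow> bool" for w where
  init: "head w (2 * length w + 2) (Running 0 (\<lambda>_. 0))"
| scan: "j \<le> length w \<Longrightarrow> head w (2 * length w + 1 - j) (Running 1 ((\<lambda>_. 0)(0 := 1, 2 := j)))"
| loop: "p \<le> length w \<Longrightarrow> loop_state w p (Suc p) R \<Longrightarrow> head w p (Running 4 R)"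

text \<open>No derivation starts past the end of the input, so the initial zeros form a correct
  window for the sweep.\<close>

lemma exact_zero: "exact w (Suc (length w)) (\<lambda>_ _. 0)"
  unfolding exact_def using der_bounds by fastforce

lemma head_bounded: "head w i c \<Longrightarrow> bounded_by (length w + 1) c"
proof (induction rule: head.induct)
  case (loop p R)
  then show ?case using loop_state_bound[OF loop(2,1)] by simp
qed auto

text \<open>The \<open>5\<close> in \<open>t\<close> counts the longest sequence of instructions
  after \<open>body\<close>: two zero tests, the decrement of the stored end, the test for the end
  of the input, and the halting instruction.\<close>

lemma head_loop_step:
  assumes w: "w \<in> lists (alphabet G)" and p: "p \<le> length w" and R: "loop_state w p (Suc p) R"
  defines "t \<equiv> stmt_size body + 5"
  shows "reaches program w t (Running 4 R) (Halted (w \<in> language G)) \<or>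
    (\<exists>i' c'. i' < p \<and> head w i' c' \<and> reaches program w t (Running 4 R) c')"
proof -
  define m where "m = 4 + stmt_size body"
  define e where "e = ev (start G) 0"
  note nth = program_nth[OF m_def, folded e_def]
  define R1 where "R1 = sem w body R"
  have body: "reaches program w (stmt_size body) (Running 4 R) (Running m R1)"
    using reaches_code[OF code_at_body] unfolding m_def R1_def .
  have R1: "loop_state w p p R1" unfolding R1_def using R p by (rule loop_state_body)
  then obtain f where f: "stores R1 p f" "exact w p f" by (auto simp: loop_state_def)
  note st = storesD[OF f(1)]
  show ?thesis
  proof (cases p)
    case 0
    have S: "start G \<in> N" using lin by (simp add: linear_conjunctive_grammar_def)
    have e: "R1 e = f (start G) 0" using st(3)[OF S] by (simp add: e_def)
    have ex: "f (start G) 0 = Suc q \<longleftrightarrow> der w (start G) 0 q" for q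
      using f(2) S 0 by (auto simp: exact_def)
    have 1: "step program w (Running m R1) = Running (m + 3) R1"
      using nth(1,6) st(2) 0 by simp
    have "reaches program w (Suc (Suc (Suc (Suc 1)))) (Running m R1) (Halted (w \<in> language G))"
    proof (cases "f (start G) 0")
      case zero: 0
      then have "w \<notin> language G" using ex language_iff_der[OF w] by auto
      have 2: "step program w (Running (m + 3) R1) = Running (m + 6) R1"
        using nth(1,9) e zero by simp
      have 3: "step program w (Running (m + 6) R1) = Halted (w \<in> language G)"
        using nth(1,12) \<open>w \<notin> language G\<close> by simp
      show ?thesis
        by (rule reaches_mono[OF reaches_Cons_step[OF 1 reaches_Cons_step[OF 2 reaches_step[OF 3]]]])
          simp
    next
      case (Suc q)
      let ?R = "R1(e := q)"
      have q: "q \<le> length w" using ex Suc der_bounds by blast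
      \<comment> \<open>The only guided derivation from the initial nonterminal at \<open>0\<close>
        ends at \<open>q\<close>.\<close>
      have "w \<in> language G \<longleftrightarrow> q = length w"
        using ex Suc language_iff_der[OF w] der_unique by blast
      also have "\<dots> \<longleftrightarrow> input_symbol w q = None" using q by (auto simp: input_symbol_def)
      finally have L: "w \<in> language G \<longleftrightarrow> input_symbol w q = None" .
      have 2: "step program w (Running (m + 3) R1) = Running (m + 4) R1"
        using nth(1,9) e Suc by simp
      have 3: "step program w (Running (m + 4) R1) = Running (m + 5) ?R"
        using nth(1,10) st(1) e Suc by simp
      have 4: "step program w (Running (m + 5) ?R) =
          Running (if w \<in> language G then m + 7 else m + 6) ?R"
        using nth(1,11) L by simp
      have 5: "step program w (Running (if w \<in> language G then m + 7 else m + 6) ?R) =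
          Halted (w \<in> language G)"
        using nth(1,12,13) by simp
      show ?thesis
        by (rule reaches_Cons_step[OF 1 reaches_Cons_step[OF 2 reaches_Cons_step[OF 3
          reaches_Cons_step[OF 4 reaches_step[OF 5]]]]])
    qed
    from reaches_trans[OF body this] have "reaches program w t (Running 4 R) (Halted (w \<in> language G))"
      by (rule reaches_mono) (simp add: t_def)
    then show ?thesis ..
  next
    case (Suc p')
    let ?R = "R1(2 := p')"
    have 1: "step program w (Running m R1) = Running (m + 1) R1"
      using nth(1,6) st(2) Suc by simp
    have 2: "step program w (Running (m + 1) R1) = Running (m + 2) ?R"
      using nth(1,7) st Suc by simp
    have 3: "step program w (Running (m + 2) ?R) = Running 4 ?R"
      using nth(1,8) by simp
    have "reaches program w (Suc (Suc 1)) (Running m R1) (Running 4 ?R)"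
      by (rule reaches_Cons_step[OF 1 reaches_Cons_step[OF 2 reaches_step[OF 3]]])
    from reaches_trans[OF body this]
    have "reaches program w t (Running 4 R) (Running 4 ?R)"
      by (rule reaches_mono) (simp add: t_def)
    moreover have "stores ?R p' f" using f(1) by (auto simp: stores_def)
    then have "loop_state w p' (Suc p') ?R"
      using f(2) R1 Suc by (auto simp: loop_state_def)
    then have "head w p' (Running 4 ?R)" using p Suc by (intro head.loop) auto
    ultimately show ?thesis using Suc by blast
  qed
qed

lemma head_step:
  assumes w: "w \<in> lists (alphabet G)" and "head w i c"
  defines "t \<equiv> stmt_size body + 5"
  shows "reaches program w t c (Halted (w \<in> language G)) \<or>
    (\<exists>i' c'. i' < i \<and> head w i' c' \<and> reaches program w t c c')"
  using \<open>head w i c\<close>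
proof cases
  case init
  have "step program w c = Running 1 ((\<lambda>_. 0)(0 := 1, 2 := 0))"
    using init program_nth[OF refl] by (simp add: fun_eq_iff)
  then have "reaches program w t c (Running 1 ((\<lambda>_. 0)(0 := 1, 2 := 0)))"
    by (intro reaches_mono[OF reaches_step]) (simp_all add: t_def)
  with head.scan[of 0 w] init show ?thesis by fastforce
next
  case (scan j)
  note nth = program_nth[OF refl]
  show ?thesis
  proof (cases "j < length w")
    case True
    let ?R = "(\<lambda>_. 0)(0 := 1, 2 := Suc j) :: nat \<Rightarrow> nat"
    have 1: "step program w c = Running 2 ((\<lambda>_. 0)(0 := 1, 2 := j))"
      using True scan nth(1,3) by (simp add: input_symbol_def numeral_2_eq_2)
    have 2: "step program w (Running 2 ((\<lambda>_. 0)(0 := 1, 2 := j))) = Running 3 ?R"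
      using nth(1,4) by simp
    have 3: "step program w (Running 3 ?R) = Running 1 ?R"
      using nth(1,5) by simp
    have "reaches program w t c (Running 1 ?R)"
      by (rule reaches_mono[OF reaches_Cons_step[OF 1 reaches_Cons_step[OF 2 reaches_step[OF 3]]]])
        (simp add: t_def)
    moreover have "head w (2 * length w + 1 - Suc j) (Running 1 ?R)"
      using True by (intro head.scan) simp
    moreover have "2 * length w + 1 - Suc j < i" using scan True by simp
    ultimately show ?thesis by blast
  next
    case False
    let ?R = "(\<lambda>_. 0)(0 := 1, 2 := length w) :: nat \<Rightarrow> nat"
    have j: "j = length w" using False scan by simp
    have "step program w c = Running 4 ?R"
      using scan nth(1,3) j by (simp add: input_symbol_def)
    then have "reaches program w t c (Running 4 ?R)"
      by (intro reaches_mono[OF reaches_step]) (simp_all add: t_def)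
    moreover have "stores ?R (length w) (\<lambda>_ _. 0)" by (auto simp: stores_def)
    then have "loop_state w (length w) (Suc (length w)) ?R"
      using exact_zero by (auto simp: loop_state_def)
    then have "head w (length w) (Running 4 ?R)" by (intro head.loop) auto
    moreover have "length w < i" using scan j by simp
    ultimately show ?thesis by blast
  qed
next
  case (loop R)
  then show ?thesis
    using head_loop_step[OF w loop(2,3)] by (simp add: t_def)
qed

lemma program_decides:
  assumes C: "consts_below C program" and w: "w \<in> lists (alphabet G)"
  defines "t \<equiv> stmt_size body + 5"
  shows "\<exists>n \<le> t * (2 * length w + 3). config_after program w n = Halted (w \<in> language G)"
    and "bounded_by (2 ^ t * (length w + 1 + C)) (config_after program w n)"
proof -
  have seg: "bounded_by (length w + 1) c \<and> (reaches program w t c (Halted (w \<in> language G)) \<or>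
      (\<exists>i' c'. i' < i \<and> head w i' c' \<and> reaches program w t c c'))" if "head w i c" for i c
    unfolding t_def using head_bounded[OF that] head_step[OF w that] by (rule conjI)
  note run = segments_terminate[where H = "head w", OF C seg head.init]
  \<comment> \<open>The initial configuration has the number \<open>2 * length w + 2\<close>, hence
    there are at most one more segments than that.\<close>
  have "t * Suc (2 * length w + 2) = t * (2 * length w + 3)" by (simp add: algebra_simps)
  with run show "\<exists>n \<le> t * (2 * length w + 3). config_after program w n = Halted (w \<in> language G)"
    unfolding reaches_def config_after_def by simp
  from run show "bounded_by (2 ^ t * (length w + 1 + C)) (config_after program w n)"
    unfolding config_after_def by blast
qed

end

section \<open>Asymptotic bounds and finiteness of the table\<close>

lemma space_bounded:
  assumes "bounded_by M c"
  shows "space P c \<le> card (\<Union>i\<in>set P. registers i) * Suc (floor_log M)"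
proof (cases c)
  case (Running pc R)
  have "bit_size (R r) \<le> Suc (floor_log M)" for r
    using assms Running by (simp add: bit_size_def floor_log_le_iff)
  with sum_bounded_above[of "\<Union>i\<in>set P. registers i" "\<lambda>r. bit_size (R r)" "Suc (floor_log M)"]
  show ?thesis unfolding Running by simp
qed simp

lemma floor_log_bigo:
  fixes a b K :: nat
  shows "(\<lambda>n. real (K * Suc (floor_log (a * (n + b))))) \<in> O(\<lambda>n. ln (real n))"
proof (rule bigoI)
  have "eventually (\<lambda>n. a + b + 2 \<le> n) at_top" by (rule eventually_ge_at_top)
  then show "\<forall>\<^sub>F n in at_top. norm (real (K * Suc (floor_log (a * (n + b))))) \<le>
      (real K * (4 / ln 2)) * norm (ln (real n))"
  proof eventually_elim
    case (elim n)
    \<comment> \<open>For \<open>n \<ge> a + b + 2\<close> the argument is at most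
      \<open>2 * n * n \<le> n ^ 3\<close>, which gives three binary logarithms of \<open>n\<close>;
      the fourth absorbs the successor.\<close>
    have "floor_log (a * (n + b)) \<le> floor_log (n * (2 * n))"
      using elim by (intro floor_log_le_iff mult_mono) auto
    also have "\<dots> \<le> floor_log (n ^ 3)"
      using elim by (intro floor_log_le_iff) (simp add: power3_eq_cube)
    finally have "real (floor_log (a * (n + b))) \<le> real (floor_log (n ^ 3))" by simp
    also have "\<dots> \<le> log 2 (real (n ^ 3))"
      using elim by (simp add: floor_log_altdef of_nat_floor)
    also have "\<dots> = 3 * ln n / ln 2"
      using elim by (simp add: log_def ln_realpow)
    finally have "real (floor_log (a * (n + b))) \<le> 3 * ln n / ln 2" .
    moreover have "1 \<le> ln n / ln 2" using elim by simp
    moreover have "4 / ln 2 * ln n = 3 * ln n / ln 2 + ln n / ln 2" by (simp add: field_simps)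
    ultimately have "real (Suc (floor_log (a * (n + b)))) \<le> 4 / ln 2 * ln n" by linarith
    then have "real K * real (Suc (floor_log (a * (n + b)))) \<le> real K * (4 / ln 2 * ln n)"
      by (rule mult_left_mono) simp
    moreover have "0 \<le> ln (real n)" using elim by simp
    ultimately show ?case by (simp add: algebra_simps)
  qed
qed

text \<open>The arguments of the table are nonterminals with strings of length at most
  \<open>k\<close> over a finite alphabet.\<close>

lemma finite_table:
  assumes "linear_conjunctive_grammar G" and "LL_table G k T"
  shows "finite {(A, x, r). T (A, x) = Some r \<and> lhs r = A}"
proof -
  let ?X = "nonterminals G \<times> {x. set x \<subseteq> alphabet G \<and> length x \<le> k}"
  have "finite ?X"
    using assms(1) by (auto simp: linear_conjunctive_grammar_def intro!: finite_lists_length_le)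
  then have "finite ((\<lambda>(A, x). (A, x, the (T (A, x)))) ` ?X)" by (rule finite_imageI)
  moreover have "{(A, x, r). T (A, x) = Some r \<and> lhs r = A} \<subseteq> (\<lambda>(A, x). (A, x, the (T (A, x)))) ` ?X"
    using assms(2) unfolding LL_table_def by (force simp: image_iff)
  ultimately show ?thesis by (rule finite_subset[rotated])
qed

lemma ll_recognizer_exists:
  assumes lin: "linear_conjunctive_grammar G" and table: "LL_table G k T"
  shows "\<exists>idx D Ns es. ll_recognizer G k T idx D Ns es"
proof -
  have fin: "finite (nonterminals G)" "finite (rules G)"
    using lin by (auto simp: linear_conjunctive_grammar_def)
  obtain idx :: "'b \<Rightarrow> nat" where idx: "inj_on idx (nonterminals G)"
    using finite_imp_inj_to_nat_seg[OF fin(1)] by blast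
  obtain Ns where Ns: "set Ns = nonterminals G" "distinct Ns"
    using finite_distinct_list[OF fin(1)] by blast
  obtain es where es: "set es = {(A, x, r). T (A, x) = Some r \<and> lhs r = A}"
    using finite_list[OF finite_table[OF lin table]] by blast
  define U where "U = (\<Union>r\<in>rules G. case r of Word A y \<Rightarrow> {} | Conj A cs \<Rightarrow> (length \<circ> fst) ` set cs)"
  have "finite U" unfolding U_def using fin(2) by (auto split: rule.split)
  then obtain D where "\<forall>n\<in>U. n \<le> D" unfolding finite_nat_set_iff_bounded_le by blast
  moreover have "length u \<in> U" if "Conj A cs \<in> rules G" "(u, B, v) \<in> set cs" for A cs u B v
    unfolding U_def using that by (force intro!: bexI[of _ "Conj A cs"])
  ultimately have "ll_recognizer G k T idx D Ns es"
    using lin table idx Ns es by unfold_locales auto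
  then show ?thesis by blast
qed

theorem theorem2:
  fixes G :: "('a, 'n) grammar" and k :: nat
  assumes "linear_conjunctive_grammar G"
    and "LL k G"
  shows "\<exists>S T. S \<in> O(\<lambda>n. ln (real n)) \<and> T \<in> O(\<lambda>n. real n) \<and>
    decidable_in_space_time (alphabet G) (language G) S T"
proof -
  from assms(2) obtain T where "LL_table G k T" by (auto simp: LL_def)
  with ll_recognizer_exists[OF assms(1)] obtain idx D Ns es where
    "ll_recognizer G k T idx D Ns es" by blast
  then interpret ll_recognizer G k T idx D Ns es .
  obtain C where C: "consts_below C program" using consts_below_exists by blast
  \<comment> \<open>The program is built from the grammar and its table alone, so \<open>t\<close>,
    \<open>C\<close> and the number of registers do not depend on the input.\<close>
  define t where "t = stmt_size body + 5"
  define S :: "nat \<Rightarrow> real" where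
    "S n = real (card (\<Union>i\<in>set program. registers i) * Suc (floor_log (2 ^ t * (n + (1 + C)))))" for n
  define Time :: "nat \<Rightarrow> real" where "Time n = real (t * (2 * n + 3))" for n
  have "S \<in> O(\<lambda>n. ln (real n))" unfolding S_def by (rule floor_log_bigo)
  moreover have "Time \<in> O(\<lambda>n. real n)"
  proof (rule bigoI)
    have "eventually (\<lambda>n. 1 \<le> n) (at_top :: nat filter)" by (rule eventually_ge_at_top)
    then show "\<forall>\<^sub>F n in at_top. norm (Time n) \<le> real (5 * t) * norm (real n)"
    proof eventually_elim
      case (elim n)
      then have "t * (2 * n + 3) \<le> t * (5 * n)" by (intro mult_le_mono2) simp
      then have "real (t * (2 * n + 3)) \<le> real (t * (5 * n))" by (rule of_nat_mono)
      then show ?case by (simp add: Time_def algebra_simps)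
    qed
  qed
  moreover have "decidable_in_space_time (alphabet G) (language G) S Time"
    unfolding decidable_in_space_time_def
  proof (intro exI[of _ program] ballI conjI allI)
    fix w n assume w: "w \<in> lists (alphabet G)"
    show "\<exists>n. real n \<le> Time (length w) \<and> config_after program w n = Halted (w \<in> language G)"
      using program_decides(1)[OF C w] unfolding Time_def t_def of_nat_le_iff by blast
    show "real (space program (config_after program w n)) \<le> S (length w)"
      using space_bounded[OF program_decides(2)[OF C w, of n], of program]
      unfolding S_def t_def of_nat_le_iff by (simp only: add.assoc)
  qed
  ultimately show ?thesis by blast
qed

end
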